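(* Let $\Sigma^{SL}$ be the system generated by the semilinear equation $\dot x(t)=Ax(t)+f(t,x(t),u(t))$, $x(t_0)=x_0$, on the Banach space $\mathcal X$, where $A$ generates a $C_0$-semigroup $T(\cdot)$ on $\mathcal X$ and $f:\mathbb R_{\ge0}\times\mathcal X\times\mathsf U\to\mathcal X$. Suppose that: (SL1) there exist a strictly increasing unbounded sequence of positive times $\{\tau_k\}_{k=1}^\infty$ and continuous functions $f_k:[\tau_k,\tau_{k+1}]\times\mathcal X\times\mathsf U\to\mathcal X$, $k=0,1,\dots$, with $\tau_0=0$, such that $f=f_k$ on $[\tau_k,\tau_{k+1})\times\mathcal X\times\mathsf U$; (SL2) for all $r>0$ there exists $L=L(r)\ge0$ such that $\|f(t,\xi,\mu)-f(t,\omega,\mu)\|_{\mathcal X}\le L\|\xi-\omega\|_{\mathcal X}$ for all $t\ge0$, all $\xi,\omega\in\mathcal X$ with norms $\le r$ and all $\mu\in\mathsf U$ with $\|\mu\|_{\mathsf U}\le r$; (SL3) there exist $\gamma\in\mathcal K_\infty$ and a non-decreasing $N:\mathbb R_{\ge0}\to\mathbb R_{>0}$ such that $\|f(t,\xi,\mu)\|_{\mathcal X}\le N(\|\xi\|_{\mathcal X})(1+\gamma(\|\mu\|_{\mathsf U}))$ for all $t\ge0$, $\xi\in\mathcal X$, $\mu\in\mathsf U$; (SL4) for every $r>0$ and $\varepsilon>0$ there exists $\delta>0$ such that for all $t\ge0$, $\|f(t,\xi,\mu)-f(t,\xi,0)\|_{\mathcal X}<\varepsilon$ if $\|\xi\|_{\mathcal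 X}\le r$ and $\|\mu\|_{\mathsf U}\le\delta$. Let $\gamma\in\mathcal K_\infty$ be the function from (SL3). Then: a) If $\Sigma^{SL}$ is iISS with gain $\kappa$, then $\Sigma^{SL}$ is 0-GUAS and UBEBS with gain $\kappa$. b) If $\Sigma^{SL}$ is 0-GUAS and UBEBS with gain $\alpha$, then $\Sigma^{SL}$ is iISS with gain $\kappa=\max\{\alpha,\gamma\}$.
   Context: Comparison functions. $\alpha\in\mathcal K$ if $\alpha:\mathbb R_{\ge0}\to\mathbb R_{\ge0}$ is continuous, strictly increasing, $\alpha(0)=0$; $\alpha\in\mathcal K_\infty$ if moreover unbounded. $\beta\in\mathcal{KL}$ if $\beta:\mathbb R_{\ge0}\times\mathbb R_{\ge0}\to\mathbb R_{\ge0}$, $\beta(\cdot,t)\in\mathcal K$ for each $t\ge0$, and for each fixed $r\ge0$, $\beta(r,t)$ decreases monotonically to $0$ as $t\to\infty$. Convention: $\rho(\infty)=\infty$ for $\rho\in\mathcal K_\infty$. Setting. $\mathcal X$ is a Banach space with norm $\|\cdot\|_{\mathcal X}$, $\mathsf U$ a normed space with norm $\|\cdot\|_{\mathsf U}$. The admissible inputs $\mathcal U$ are all piecewise continuous functions $u:\mathbb R_{\ge0}\to\mathsf U$ (finitely many discontinuities on each bounded interval, with one-sided limits there); $\mathbf 0$ is the zero input. A weak solution on $J=[t_0,\tau)$ or $[t_0,\tau]$ is a continuous $x:J\to\mathcal X$ with $x(t)=T(t-t_0)x_0+\int_{t_0}^tT(t-s)f(s,x(s),u(s))\,ds$ for all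 $t\in J$ (Bochner integral). Under (SL1)--(SL3), for every $t_0\ge0$, $x_0\in\mathcal X$, $u\in\mathcal U$ there is a unique maximally defined weak solution $x:[t_0,t_{(t_0,x_0,u)})\to\mathcal X$; write $\phi(t,t_0,x_0,u)=x(t)$. The system generated by the equation is $\Sigma^{SL}=(\mathcal X,\mathcal U,\phi)$. It is forward complete if $t_{(t_0,x_0,u)}=\infty$ always. For $\kappa\in\mathcal K_\infty$, $\|u\|_\kappa=\int_0^\infty\kappa(\|u(s)\|_{\mathsf U})\,ds\in[0,\infty]$. Stability notions. 0-GUAS: there is $\beta\in\mathcal{KL}$ such that for all $t_0\ge0$, $x_0\in\mathcal X$, $\phi(t,t_0,x_0,\mathbf 0)$ is defined for all $t\ge t_0$ and $\|\phi(t,t_0,x_0,\mathbf 0)\|_{\mathcal X}\le\beta(\|x_0\|_{\mathcal X},t-t_0)$. UBEBS with gain $\kappa\in\mathcal K_\infty$: $\Sigma^{SL}$ is forward complete and there are $\alpha',\rho\in\mathcal K_\infty$, $c\ge0$ such that $\|\phi(t,t_0,x_0,u)\|_{\mathcal X}\le c+\alpha'(\|x_0\|_{\mathcal X})+\rho(\|u\|_\kappa)$ for all $t\ge t_0\ge0$, $x_0\in\mathcal X$, $u\in\mathcal U$. iISS with gain $\kappa\in\mathcal K_\infty$: $\Sigma^{SL}$ is forward complete and there are $\beta\in\mathcal{KL}$, $\rho\in\mathcal K_\infty$ such that $\|\phi(t,t_0,x_0,u)\|_{\mathcal X}\le\beta(\|x_0\|_{\mathcal X},t-t_0)+\rho(\|u\|_\kappa)$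 for all $t\ge t_0\ge0$, $x_0\in\mathcal X$, $u\in\mathcal U$. *)

theory Defs
  imports "HOL-Analysis.Analysis"
begin

section \<open>Comparison functions\<close>

text \<open>Functions on the nonnegative reals are rendered as functions on \<^typ>\<open>real\<close> of which only the
  restriction to \<open>{0..}\<close> matters.\<close>

definition class_K :: "(real \<Rightarrow> real) \<Rightarrow> bool" where
  "class_K a \<longleftrightarrow> a ` {0..} \<subseteq> {0..} \<and> continuous_on {0..} a \<and> strict_mono_on {0..} a \<and> a 0 = 0"

definition class_Kinf :: "(real \<Rightarrow> real) \<Rightarrow> bool" where
  "class_Kinf a \<longleftrightarrow> class_K a \<and> \<not> bdd_above (a ` {0..})"

definition class_KL :: "(real \<Rightarrow> real \<Rightarrow> real) \<Rightarrow> bool" where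
  "class_KL b \<longleftrightarrow> (\<forall>t\<ge>0. class_K (\<lambda>r. b r t)) \<and>
     (\<forall>r\<ge>0. antimono_on {0..} (b r) \<and> (b r \<longlongrightarrow> 0) at_top)"

text \<open>Extension of \<open>\<rho>\<close> to \<open>[0,\<infinity>]\<close> with the convention \<open>\<rho>(\<infinity>) = \<infinity>\<close>.\<close>

definition ext_gain :: "(real \<Rightarrow> real) \<Rightarrow> ennreal \<Rightarrow> ennreal" where
  "ext_gain \<rho> a = (if a = \<infinity> then \<infinity> else ennreal (\<rho> (enn2real a)))"


section \<open>Strongly continuous semigroups\<close>

definition C0_semigroup :: "(real \<Rightarrow> 'x::real_normed_vector \<Rightarrow>\<^sub>L 'x) \<Rightarrow> bool" where
  "C0_semigroup T \<longleftrightarrow> T 0 = id_blinfun \<and> (\<forall>s\<ge>0. \<forall>t\<ge>0. T (s + t) = T s o\<^sub>L T t) \<and>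
     (\<forall>x. ((\<lambda>t. T t x) \<longlongrightarrow> x) (at_right 0))"

text \<open>The (in general unbounded) operator \<open>A\<close> with domain \<open>D\<close> generates \<open>T\<close>; values of \<open>A\<close> outside
  \<open>D\<close> are irrelevant.\<close>

definition generates ::
  "'x set \<Rightarrow> ('x \<Rightarrow> 'x) \<Rightarrow> (real \<Rightarrow> 'x::real_normed_vector \<Rightarrow>\<^sub>L 'x) \<Rightarrow> bool" where
  "generates D A T \<longleftrightarrow>
     D = {x. \<exists>y. ((\<lambda>h. (T h x - x) /\<^sub>R h) \<longlongrightarrow> y) (at_right 0)} \<and>
     (\<forall>x\<in>D. ((\<lambda>h. (T h x - x) /\<^sub>R h) \<longlongrightarrow> A x) (at_right 0))"


section \<open>The Bochner integral in arbitrary normed spaces\<close>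

text \<open>The library restricts \<^const>\<open>has_bochner_integral\<close> to second countable (i.e. separable) target
  spaces. This is the same definition without that restriction; the approximation by simple
  functions enforces strong measurability.\<close>

definition has_bochner_integral_gen ::
  "'a measure \<Rightarrow> ('a \<Rightarrow> 'b::real_normed_vector) \<Rightarrow> 'b \<Rightarrow> bool" where
  "has_bochner_integral_gen M f x \<longleftrightarrow> f \<in> borel_measurable M \<and>
     (\<exists>s. (\<forall>i. Bochner_Integration.simple_bochner_integrable M (s i)) \<and>
       (\<lambda>i. \<integral>\<^sup>+y. norm (f y - s i y) \<partial>M) \<longlonglongrightarrow> 0 \<and>
       (\<lambda>i. Bochner_Integration.simple_bochner_integral M (s i)) \<longlonglongrightarrow> x)"

lemma has_bochner_integral_gen_eq:
  fixes f :: "'a \<Rightarrow> 'b::{real_normed_vector, second_countable_topology}"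
  shows "has_bochner_integral_gen M f x \<longleftrightarrow> has_bochner_integral M f x"
  unfolding has_bochner_integral_gen_def has_bochner_integral.simps by blast


section \<open>Weak solutions of the semilinear equation\<close>

text \<open>Piecewise continuous inputs on \<open>[0,\<infinity>)\<close>. At points of continuity the one-sided limits exist
  anyway, so they are required everywhere.\<close>

definition admissible_input :: "(real \<Rightarrow> 'u::real_normed_vector) \<Rightarrow> bool" where
  "admissible_input u \<longleftrightarrow>
     (\<forall>b\<ge>0. finite {s \<in> {0..b}. \<not> continuous (at s within {0..}) u}) \<and>
     (\<forall>s\<ge>0. \<exists>l. (u \<longlongrightarrow> l) (at_right s)) \<and>
     (\<forall>s>0. \<exists>l. (u \<longlongrightarrow> l) (at_left s))"

definition interval_to :: "real \<Rightarrow> ereal \<Rightarrow> real set" where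
  "interval_to t0 \<tau> = {t. t0 \<le> t \<and> ereal t < \<tau>}"

definition solution_interval :: "real \<Rightarrow> real set \<Rightarrow> bool" where
  "solution_interval t0 J \<longleftrightarrow>
     (\<exists>\<tau>. ereal t0 < \<tau> \<and> J = interval_to t0 \<tau>) \<or> (\<exists>\<tau>>t0. J = {t0..\<tau>})"

definition weak_solution ::
  "(real \<Rightarrow> 'x::real_normed_vector \<Rightarrow>\<^sub>L 'x) \<Rightarrow> (real \<Rightarrow> 'x \<Rightarrow> 'u::real_normed_vector \<Rightarrow> 'x) \<Rightarrow>
   real \<Rightarrow> 'x \<Rightarrow> (real \<Rightarrow> 'u) \<Rightarrow> real set \<Rightarrow> (real \<Rightarrow> 'x) \<Rightarrow> bool" where
  "weak_solution T f t0 x0 u J x \<longleftrightarrow> continuous_on J x \<and>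
     (\<forall>t\<in>J. \<exists>I. has_bochner_integral_gen (lebesgue_on {t0..t}) (\<lambda>s. T (t - s) (f s (x s) (u s))) I \<and>
        x t = T (t - t0) x0 + I)"

text \<open>\<open>x\<close> is a maximally defined weak solution, with lifespan \<open>[t0,\<tau>)\<close>.\<close>

definition maximal_weak_solution ::
  "(real \<Rightarrow> 'x::real_normed_vector \<Rightarrow>\<^sub>L 'x) \<Rightarrow> (real \<Rightarrow> 'x \<Rightarrow> 'u::real_normed_vector \<Rightarrow> 'x) \<Rightarrow>
   real \<Rightarrow> 'x \<Rightarrow> (real \<Rightarrow> 'u) \<Rightarrow> ereal \<Rightarrow> (real \<Rightarrow> 'x) \<Rightarrow> bool" where
  "maximal_weak_solution T f t0 x0 u \<tau> x \<longleftrightarrow>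
     ereal t0 < \<tau> \<and> weak_solution T f t0 x0 u (interval_to t0 \<tau>) x \<and>
     (\<forall>J y. solution_interval t0 J \<and> weak_solution T f t0 x0 u J y \<and>
        interval_to t0 \<tau> \<subseteq> J \<and> (\<forall>t\<in>interval_to t0 \<tau>. y t = x t) \<longrightarrow> J = interval_to t0 \<tau>)"

text \<open>The transition map. Solutions are unique only as functions on their lifespan, hence the
  description ranges over values rather than over solutions. The result is unspecified outside the
  lifespan.\<close>

definition flow ::
  "(real \<Rightarrow> 'x::real_normed_vector \<Rightarrow>\<^sub>L 'x) \<Rightarrow> (real \<Rightarrow> 'x \<Rightarrow> 'u::real_normed_vector \<Rightarrow> 'x) \<Rightarrow>
   real \<Rightarrow> real \<Rightarrow> 'x \<Rightarrow> (real \<Rightarrow> 'u) \<Rightarrow> 'x" where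
  "flow T f t t0 x0 u =
     (THE v. \<exists>\<tau> x. maximal_weak_solution T f t0 x0 u \<tau> x \<and> t \<in> interval_to t0 \<tau> \<and> v = x t)"

definition globally_defined ::
  "(real \<Rightarrow> 'x::real_normed_vector \<Rightarrow>\<^sub>L 'x) \<Rightarrow> (real \<Rightarrow> 'x \<Rightarrow> 'u::real_normed_vector \<Rightarrow> 'x) \<Rightarrow>
   real \<Rightarrow> 'x \<Rightarrow> (real \<Rightarrow> 'u) \<Rightarrow> bool" where
  "globally_defined T f t0 x0 u \<longleftrightarrow> (\<exists>x. maximal_weak_solution T f t0 x0 u \<infinity> x)"

definition forward_complete ::
  "(real \<Rightarrow> 'x::real_normed_vector \<Rightarrow>\<^sub>L 'x) \<Rightarrow> (real \<Rightarrow> 'x \<Rightarrow> 'u::real_normed_vector \<Rightarrow> 'x) \<Rightarrow> bool" where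
  "forward_complete T f \<longleftrightarrow>
     (\<forall>t0\<ge>0. \<forall>x0 u. admissible_input u \<longrightarrow> globally_defined T f t0 x0 u)"


section \<open>Standing assumptions on the nonlinearity\<close>

text \<open>\<open>f t\<close> is relevant only for \<open>t \<ge> 0\<close>. Positivity of \<open>\<tau> k\<close> for \<open>k \<ge> 1\<close> follows from
  \<open>\<tau> 0 = 0\<close> and strict monotonicity.\<close>

definition SL1 :: "(real \<Rightarrow> 'x::real_normed_vector \<Rightarrow> 'u::real_normed_vector \<Rightarrow> 'x) \<Rightarrow> bool" where
  "SL1 f \<longleftrightarrow> (\<exists>(\<tau> :: nat \<Rightarrow> real) (F :: nat \<Rightarrow> real \<Rightarrow> 'x \<Rightarrow> 'u \<Rightarrow> 'x).
     \<tau> 0 = 0 \<and> strict_mono \<tau> \<and> \<not> bdd_above (range \<tau>) \<and>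
     (\<forall>k. continuous_on ({\<tau> k..\<tau> (Suc k)} \<times> UNIV \<times> UNIV) (\<lambda>(t, \<xi>, \<mu>). F k t \<xi> \<mu>)) \<and>
     (\<forall>k. \<forall>t\<in>{\<tau> k..<\<tau> (Suc k)}. \<forall>\<xi> \<mu>. f t \<xi> \<mu> = F k t \<xi> \<mu>))"

definition SL2 :: "(real \<Rightarrow> 'x::real_normed_vector \<Rightarrow> 'u::real_normed_vector \<Rightarrow> 'x) \<Rightarrow> bool" where
  "SL2 f \<longleftrightarrow> (\<forall>r>0. \<exists>L\<ge>0. \<forall>t\<ge>0. \<forall>\<xi> \<omega> \<mu>. norm \<xi> \<le> r \<and> norm \<omega> \<le> r \<and> norm \<mu> \<le> r \<longrightarrow>
     norm (f t \<xi> \<mu> - f t \<omega> \<mu>) \<le> L * norm (\<xi> - \<omega>))"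

definition SL3 ::
  "(real \<Rightarrow> real) \<Rightarrow> (real \<Rightarrow> 'x::real_normed_vector \<Rightarrow> 'u::real_normed_vector \<Rightarrow> 'x) \<Rightarrow> bool" where
  "SL3 \<gamma> f \<longleftrightarrow> class_Kinf \<gamma> \<and> (\<exists>N :: real \<Rightarrow> real. mono_on {0..} N \<and> (\<forall>r\<ge>0. N r > 0) \<and>
     (\<forall>t\<ge>0. \<forall>\<xi> \<mu>. norm (f t \<xi> \<mu>) \<le> N (norm \<xi>) * (1 + \<gamma> (norm \<mu>))))"

definition SL4 :: "(real \<Rightarrow> 'x::real_normed_vector \<Rightarrow> 'u::real_normed_vector \<Rightarrow> 'x) \<Rightarrow> bool" where
  "SL4 f \<longleftrightarrow> (\<forall>r>0. \<forall>\<epsilon>>0. \<exists>\<delta>>0. \<forall>t\<ge>0. \<forall>\<xi> \<mu>. norm \<xi> \<le> r \<and> norm \<mu> \<le> \<delta> \<longrightarrow>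
     norm (f t \<xi> \<mu> - f t \<xi> 0) < \<epsilon>)"


section \<open>Stability notions\<close>

definition input_energy :: "(real \<Rightarrow> real) \<Rightarrow> (real \<Rightarrow> 'u::real_normed_vector) \<Rightarrow> ennreal" where
  "input_energy \<kappa> u = (\<integral>\<^sup>+s\<in>{0..}. ennreal (\<kappa> (norm (u s))) \<partial>lborel)"

definition zero_GUAS ::
  "(real \<Rightarrow> 'x::real_normed_vector \<Rightarrow>\<^sub>L 'x) \<Rightarrow> (real \<Rightarrow> 'x \<Rightarrow> 'u::real_normed_vector \<Rightarrow> 'x) \<Rightarrow> bool" where
  "zero_GUAS T f \<longleftrightarrow> (\<exists>\<beta>. class_KL \<beta> \<and> (\<forall>t0\<ge>0. \<forall>x0. globally_defined T f t0 x0 (\<lambda>_. 0) \<and>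
     (\<forall>t\<ge>t0. norm (flow T f t t0 x0 (\<lambda>_. 0)) \<le> \<beta> (norm x0) (t - t0))))"

definition UBEBS ::
  "(real \<Rightarrow> 'x::real_normed_vector \<Rightarrow>\<^sub>L 'x) \<Rightarrow> (real \<Rightarrow> 'x \<Rightarrow> 'u::real_normed_vector \<Rightarrow> 'x) \<Rightarrow>
   (real \<Rightarrow> real) \<Rightarrow> bool" where
  "UBEBS T f \<kappa> \<longleftrightarrow> class_Kinf \<kappa> \<and> forward_complete T f \<and>
     (\<exists>a \<rho> c. class_Kinf a \<and> class_Kinf \<rho> \<and> c \<ge> 0 \<and>
       (\<forall>t0\<ge>0. \<forall>t\<ge>t0. \<forall>x0 u. admissible_input u \<longrightarrow>
         ennreal (norm (flow T f t t0 x0 u))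
           \<le> ennreal (c + a (norm x0)) + ext_gain \<rho> (input_energy \<kappa> u)))"

definition iISS ::
  "(real \<Rightarrow> 'x::real_normed_vector \<Rightarrow>\<^sub>L 'x) \<Rightarrow> (real \<Rightarrow> 'x \<Rightarrow> 'u::real_normed_vector \<Rightarrow> 'x) \<Rightarrow>
   (real \<Rightarrow> real) \<Rightarrow> bool" where
  "iISS T f \<kappa> \<longleftrightarrow> class_Kinf \<kappa> \<and> forward_complete T f \<and>
     (\<exists>\<beta> \<rho>. class_KL \<beta> \<and> class_Kinf \<rho> \<and>
       (\<forall>t0\<ge>0. \<forall>t\<ge>t0. \<forall>x0 u. admissible_input u \<longrightarrow>
         ennreal (norm (flow T f t t0 x0 u))
           \<le> ennreal (\<beta> (norm x0) (t - t0)) + ext_gain \<rho> (input_energy \<kappa> u)))"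

end

theory Submission
  imports Defs
begin

text \<open>
  That iISS implies 0-GUAS and UBEBS is seen by inserting the zero input, respectively by bounding
  \<open>\<beta> r t\<close> by \<open>\<beta> r 0\<close>. The converse rests on the following idea.

  Over a time window of fixed length, and inside a fixed ball, a forced trajectory deviates from the
  unforced one with the same initial state by at most \<open>\<eta> + C w\<close>, where \<open>w\<close> is the \<open>\<gamma>\<close>-energy of the input
  on the window, and \<open>\<eta>\<close> can be made arbitrarily small at the expense of \<open>C\<close> (lemma \<open>flow_perturbation\<close>):
  (SL4) deals with small input values, (SL3) with the others, and Gronwall's inequality with the dependence on the
  state. UBEBS provides the ball, and 0-GUAS the contraction of the unforced flow.

  From this two facts follow. First, small initial states with small energy
  produce small trajectories, since every window on which little energy is spent maps a small ball into
  itself (\<open>uniform_local_stability\<close>). So there is a monotone function \<open>S\<close> (\<open>gain\<close>) that tends to \<open>0\<close> at \<open>0\<close> and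
  satisfies \<open>norm (x t) \<le> S (max (norm x0) E)\<close>, where \<open>E\<close> is the energy; in particular the offset in the UBEBS
  bound has disappeared. Second, if \<open>norm x0 \<le> r\<close> and \<open>E \<le> r\<close>, then among sufficiently many
  windows one carries so little energy that the trajectory becomes as small as desired by the end of it
  (\<open>uniform_reach\<close>). Restarting there gives \<open>norm (x t) \<le> \<epsilon> + S E\<close> after a time that depends on
  \<open>r\<close> and \<open>\<epsilon>\<close> only; for \<open>E \<ge> r\<close> this bound holds from the beginning (\<open>uniform_asymptotic_gain\<close>).
  The supremum of \<open>norm (x t) - S E\<close> over all trajectories from the ball of radius \<open>r\<close> and all sufficiently
  late times is then monotone, tends to \<open>0\<close> as time grows, and is turned into a \<open>KL\<close> function by an averaging that
  restores continuity (\<open>dilation_mean\<close>); the same averaging turns \<open>S\<close> into the gain.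

  It remains to establish uniqueness of solutions, the cocycle property and the perturbation bound for the
  given equation. The integrands in the variation of constants formula have one-sided limits
  everywhere, so their Bochner integrals are Henstock-Kurzweil integrals, for which linearity, additivity and
  norm bounds hold in every Banach space.
\<close>

section \<open>Comparison functions\<close>

lemma class_K_mono: "\<lbrakk>class_K a; 0 \<le> r; r \<le> s\<rbrakk> \<Longrightarrow> a r \<le> a s"
  by (cases "r = s") (auto simp: class_K_def strict_mono_on_def intro!: less_imp_le)

lemma class_K_nonneg: "\<lbrakk>class_K a; 0 \<le> r\<rbrakk> \<Longrightarrow> 0 \<le> a r"
  by (auto simp: class_K_def)

lemma mono_on_integrable_on:
  fixes g :: "real \<Rightarrow> real"
  assumes "mono_on {a..b} g"
  shows "g integrable_on {a..b}"
proof (cases "a \<le> b")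
  case True
  define g' where "g' x = g (max a (min b x))" for x
  have mono: "mono g'"
    unfolding g'_def using True by (intro monoI mono_onD[OF assms]) auto
  have meas: "g' \<in> borel_measurable (lebesgue_on {a..b})"
    using borel_measurable_mono[OF mono]
    by (intro measurable_restrict_space1) (auto intro: measurable_completion)
  have bound: "norm (g' x) \<le> \<bar>g a\<bar> + \<bar>g b\<bar>" if "x \<in> {a..b}" for x
    using mono_onD[OF assms, of a x] mono_onD[OF assms, of x b] that
    by (auto simp: g'_def)
  have "g' integrable_on {a..b}"
    by (rule measurable_bounded_by_integrable_imp_integrable[OF meas _ bound]) auto
  then show ?thesis
    by (rule integrable_eq) (auto simp: g'_def)
qed (auto intro: integrable_on_empty)

text \<open>The suprema over trajectories that occur below are monotone but may jump, whereas class \<open>K\<close> asks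
for continuity. Averaging \<open>g\<close> over the dilations \<open>r \<mapsto> r l\<close> with \<open>1 \<le> l \<le> 2\<close> repairs this: the
average is continuous, keeps the monotonicity in \<open>r\<close> and in any further parameter, and lies between
\<open>g r\<close> and \<open>g (2 r)\<close>, so that it inherits limits from \<open>g\<close>.\<close>

definition dilation_mean :: "(real \<Rightarrow> real) \<Rightarrow> real \<Rightarrow> real" where
  "dilation_mean g r = integral {1..2} (\<lambda>l. g (r * l))"

lemma dilation_integrable:
  fixes g :: "real \<Rightarrow> real"
  assumes "mono_on {0..} g" "r \<ge> 0"
  shows "(\<lambda>l. g (r * l)) integrable_on {1..2::real}"
proof (rule mono_on_integrable_on)
  show "mono_on {1..2} (\<lambda>l. g (r * l))"
  proof (rule mono_onI)
    fix l m :: real assume "l \<in> {1..2}" "m \<in> {1..2}" "l \<le> m"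
    then show "g (r * l) \<le> g (r * m)"
      using assms(2) by (intro mono_onD[OF assms(1)] mult_left_mono) auto
  qed
qed

lemma dilation_mean_ge:
  assumes "mono_on {0..} g" "r \<ge> 0"
  shows "g r \<le> dilation_mean g r"
proof -
  have "integral {1..2::real} (\<lambda>_. g r) \<le> dilation_mean g r"
    unfolding dilation_mean_def
  proof (rule integral_le)
    fix l :: real assume "l \<in> {1..2}"
    then have "r * 1 \<le> r * l" using assms(2) by (intro mult_left_mono) auto
    then show "g r \<le> g (r * l)"
      using assms by (intro mono_onD[OF assms(1)]) auto
  qed (auto intro: dilation_integrable assms)
  then show ?thesis by simp
qed

lemma dilation_mean_le:
  assumes "mono_on {0..} g" "r \<ge> 0"
  shows "dilation_mean g r \<le> g (2 * r)"
proof -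
  have "dilation_mean g r \<le> integral {1..2::real} (\<lambda>_. g (2 * r))"
    unfolding dilation_mean_def
  proof (rule integral_le)
    fix l :: real assume "l \<in> {1..2}"
    then have "r * l \<le> r * 2" using assms(2) by (intro mult_left_mono) auto
    then show "g (r * l) \<le> g (2 * r)"
      using assms \<open>l \<in> {1..2}\<close> by (intro mono_onD[OF assms(1)]) (auto simp: mult.commute)
  qed (auto intro: dilation_integrable assms)
  then show ?thesis by simp
qed

lemma dilation_mean_mono:
  assumes "mono_on {0..} g" "mono_on {0..} h" "\<And>s. s \<ge> 0 \<Longrightarrow> g s \<le> h s" "0 \<le> r" "r \<le> r'"
  shows "dilation_mean g r \<le> dilation_mean h r'"
  unfolding dilation_mean_def
proof (rule integral_le)
  fix l :: real assume l: "l \<in> {1..2}"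
  then have "r * l \<le> r' * l" using assms by (intro mult_right_mono) auto
  then have "g (r * l) \<le> g (r' * l)"
    using assms l by (intro mono_onD[OF assms(1)]) auto
  also have "g (r' * l) \<le> h (r' * l)" using assms l by auto
  finally show "g (r * l) \<le> h (r' * l)" .
qed (use assms in \<open>auto intro: dilation_integrable\<close>)

text \<open>After the substitution \<open>s = r l\<close> the mean becomes \<open>(G (2 r) - G r) / r\<close> with \<open>G\<close> an indefinite
  integral of \<open>g\<close>, which is continuous although \<open>g\<close> may jump.\<close>

lemma dilation_mean_continuous_on:
  assumes mono: "mono_on {0..} g" and lim: "(g \<longlongrightarrow> 0) (at_right 0)" and g0: "g 0 = 0"
  shows "continuous_on {0..} (dilation_mean g)"
  unfolding continuous_on_def
proof
  fix r :: real assume "r \<in> {0..}"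
  define G where "G x = integral {0..x} g" for x
  have int: "g integrable_on {a..b}" if "0 \<le> a" for a b
    using that by (intro mono_on_integrable_on mono_on_subset[OF mono]) auto
  have eq: "dilation_mean g s = (G (2 * s) - G s) / s" if "s > 0" for s
  proof -
    have "(g has_integral integral {s..2 * s} g) {s..2 * s}"
      using int that by (intro integrable_integral) auto
    then have "((\<lambda>x. g (s * x)) has_integral (1 / \<bar>s\<bar>) *\<^sub>R integral {s..2 * s} g)
        ((\<lambda>x. x / s) ` {s..2 * s})"
      using that by (intro has_integral_stretch_real) auto
    moreover have "(\<lambda>x. x / s) ` {s..2 * s} = {1..2}"
      using that image_divide_atLeastAtMost[of s s "2 * s"] by simp
    ultimately have "dilation_mean g s = integral {s..2 * s} g / s"
      unfolding dilation_mean_def using that by (simp add: integral_unique)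
    moreover have "G s + integral {s..2 * s} g = G (2 * s)"
      unfolding G_def using that by (intro Henstock_Kurzweil_Integration.integral_combine int) auto
    ultimately show ?thesis by simp
  qed
  show "(dilation_mean g \<longlongrightarrow> dilation_mean g r) (at r within {0..})"
  proof (cases "r = 0")
    case False
    then have r: "r > 0" using \<open>r \<in> {0..}\<close> by simp
    have "continuous_on {0..3 * r} G"
      unfolding G_def by (intro indefinite_integral_continuous_1 int) simp
    then have G: "isCont G x" if "0 < x" "x < 3 * r" for x
      using that by (intro continuous_on_interior[of "{0..3 * r}"]) auto
    have "isCont (\<lambda>s. G (2 * s)) r"
      using G[of "2 * r"] r by (intro isCont_o2[where f = "\<lambda>s. 2 * s" and g = G]) auto
    then have "isCont (\<lambda>s. (G (2 * s) - G s) / s) r"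
      using G[of r] r by (intro continuous_intros) auto
    then have "((\<lambda>s. (G (2 * s) - G s) / s) \<longlongrightarrow> (G (2 * r) - G r) / r) (at r)"
      by (simp add: isCont_def)
    moreover have "\<forall>\<^sub>F s in at r. (G (2 * s) - G s) / s = dilation_mean g s"
      using order_tendstoD(1)[OF tendsto_ident_at r] by (rule eventually_mono) (simp add: eq)
    ultimately have "(dilation_mean g \<longlongrightarrow> dilation_mean g r) (at r)"
      using eq[OF r] by (simp add: tendsto_cong)
    then show ?thesis by (rule tendsto_within_subset) simp
  next
    case True
    have zero: "dilation_mean g 0 = 0" by (simp add: dilation_mean_def g0)
    have "filterlim (\<lambda>s::real. 2 * s) (at_right 0) (at_right 0)"
      by (auto simp: filterlim_at eventually_at_filter intro!: tendsto_eq_intros)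
    from filterlim_compose[OF lim this] have up: "((\<lambda>s. g (2 * s)) \<longlongrightarrow> 0) (at_right 0)" .
    have "(dilation_mean g \<longlongrightarrow> 0) (at_right 0)"
    proof (rule tendsto_sandwich[OF _ _ lim up])
      show "\<forall>\<^sub>F s in at_right 0. g s \<le> dilation_mean g s"
        by (auto simp: eventually_at_filter intro!: always_eventually dilation_mean_ge mono)
      show "\<forall>\<^sub>F s in at_right 0. dilation_mean g s \<le> g (2 * s)"
        by (auto simp: eventually_at_filter intro!: always_eventually dilation_mean_le mono)
    qed
    moreover have "at (0::real) within {0..} = at_right 0"
      by (rule at_within_Ici_at_right)
    ultimately show ?thesis using True zero by simp
  qed
qed

text \<open>The average alone is monotone but possibly locally constant; a linear term makes it strictly
increasing. In the \<open>KL\<close> application its slope will be \<open>exp (- t)\<close>, to vanish with time.\<close>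

lemma class_K_dilation_mean_plus:
  assumes mono: "mono_on {0..} g" and lim: "(g \<longlongrightarrow> 0) (at_right 0)" and g0: "g 0 = 0"
    and c: "c > 0"
  shows "class_K (\<lambda>r. dilation_mean g r + c * r)"
proof -
  have nonneg: "0 \<le> dilation_mean g r" if "r \<ge> 0" for r
    using dilation_mean_ge[OF mono that] mono_onD[OF mono, of 0 r] that g0 by auto
  have "dilation_mean g r + c * r < dilation_mean g r' + c * r'" if "0 \<le> r" "r < r'" for r r'
    using dilation_mean_mono[OF mono mono _ that(1), of r'] that c by (intro add_le_less_mono) auto
  moreover have "dilation_mean g 0 = 0" by (simp add: dilation_mean_def g0)
  moreover have "continuous_on {0..} (\<lambda>r. dilation_mean g r + c * r)"
    by (intro continuous_intros dilation_mean_continuous_on assms)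
  ultimately show ?thesis
    using nonneg c by (auto simp: class_K_def strict_mono_on_def)
qed

lemma class_Kinf_dilation_mean_plus_id:
  assumes mono: "mono_on {0..} g" and lim: "(g \<longlongrightarrow> 0) (at_right 0)" and g0: "g 0 = 0"
  shows "class_Kinf (\<lambda>r. dilation_mean g r + r)"
proof -
  have "\<not> bdd_above ((\<lambda>r. dilation_mean g r + r) ` {0..})"
  proof
    assume "bdd_above ((\<lambda>r. dilation_mean g r + r) ` {0..})"
    then obtain B where B: "\<And>r. r \<ge> 0 \<Longrightarrow> dilation_mean g r + r \<le> B"
      unfolding bdd_above_def by auto
    have "0 \<le> dilation_mean g (\<bar>B\<bar> + 1)"
      using dilation_mean_ge[OF mono, of "\<bar>B\<bar> + 1"] mono_onD[OF mono, of 0 "\<bar>B\<bar> + 1"] g0 by auto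
    then show False using B[of "\<bar>B\<bar> + 1"] by auto
  qed
  then show ?thesis
    using class_K_dilation_mean_plus[OF assms, of 1] by (simp add: class_Kinf_def)
qed

section \<open>Integral input-to-state stability of perturbed uniformly stable flows\<close>

text \<open>The part of the argument that does not depend on where the flow comes from. Here \<open>U\<close> consists of the
inputs of finite energy \<open>en\<close>, and \<open>w u a b\<close> is the energy that \<open>u\<close> spends on the window \<open>[a, b]\<close>.
The last assumption says that over a bounded time, and as long as everything stays in a ball, the
input displaces the trajectory by an amount controlled by the energy spent meanwhile, up to an
arbitrarily small error \<open>\<eta>\<close> that is paid for by a large constant \<open>C\<close>.\<close>

locale perturbed_flow =
  fixes \<phi> :: "real \<Rightarrow> real \<Rightarrow> 'x::real_normed_vector \<Rightarrow> 'i \<Rightarrow> 'x"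
    and U :: "'i set" and zero :: 'i
    and en :: "'i \<Rightarrow> real" and w :: "'i \<Rightarrow> real \<Rightarrow> real \<Rightarrow> real"
    and \<beta> :: "real \<Rightarrow> real \<Rightarrow> real"
  assumes initial: "\<lbrakk>0 \<le> t0; u \<in> U\<rbrakk> \<Longrightarrow> \<phi> t0 t0 x u = x"
    and cocycle: "\<lbrakk>0 \<le> t0; t0 \<le> s; s \<le> t; u \<in> U\<rbrakk> \<Longrightarrow> \<phi> t s (\<phi> s t0 x u) u = \<phi> t t0 x u"
    and window_add: "\<lbrakk>0 \<le> a; a \<le> b; b \<le> c; u \<in> U\<rbrakk> \<Longrightarrow> w u a c = w u a b + w u b c"
    and window_le: "\<lbrakk>0 \<le> a; a \<le> b; u \<in> U\<rbrakk> \<Longrightarrow> w u a b \<le> en u"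
    and energy_nonneg: "u \<in> U \<Longrightarrow> 0 \<le> en u"
    and bounded: "\<exists>R. \<forall>t0\<ge>0. \<forall>t\<ge>t0. \<forall>x. \<forall>u\<in>U. norm x \<le> r \<longrightarrow> en u \<le> r \<longrightarrow> norm (\<phi> t t0 x u) \<le> R"
    and KL: "class_KL \<beta>"
    and zero_decay: "\<lbrakk>0 \<le> t0; t0 \<le> t\<rbrakk> \<Longrightarrow> norm (\<phi> t t0 x zero) \<le> \<beta> (norm x) (t - t0)"
    and perturbation: "\<lbrakk>0 < R; 0 < \<tau>; 0 < \<eta>\<rbrakk> \<Longrightarrow> \<exists>C\<ge>0. \<forall>t0\<ge>0. \<forall>x. \<forall>u\<in>U.
        (\<forall>t\<in>{t0..t0 + \<tau>}. norm (\<phi> t t0 x u) \<le> R \<and> norm (\<phi> t t0 x zero) \<le> R) \<longrightarrow>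
        (\<forall>t\<in>{t0..t0 + \<tau>}. norm (\<phi> t t0 x u - \<phi> t t0 x zero) \<le> \<eta> + C * w u t0 (t0 + \<tau>))"
begin

lemma \<beta>_mono: "\<beta> r t \<le> \<beta> r' t'" if "0 \<le> r" "r \<le> r'" "0 \<le> t'" "t' \<le> t"
proof -
  have "\<beta> r t \<le> \<beta> r t'"
    using KL that by (auto simp: class_KL_def monotone_on_def)
  also have "\<beta> r t' \<le> \<beta> r' t'"
    using KL that by (intro class_K_mono[of "\<lambda>r. \<beta> r t'"]) (simp_all add: class_KL_def)
  finally show ?thesis .
qed

lemma \<beta>_nonneg: "0 \<le> \<beta> r t" if "0 \<le> r" "0 \<le> t"
  using KL that by (intro class_K_nonneg[of "\<lambda>r. \<beta> r t"]) (simp_all add: class_KL_def)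

lemma \<beta>_small_time:
  assumes "0 \<le> r" "0 < \<epsilon>"
  obtains \<tau> where "0 < \<tau>" "\<beta> r \<tau> \<le> \<epsilon>"
proof -
  have "(\<beta> r \<longlongrightarrow> 0) at_top" using KL assms by (auto simp: class_KL_def)
  then have "\<forall>\<^sub>F t in at_top. \<beta> r t < \<epsilon>" using assms by (auto dest: order_tendstoD)
  then obtain N where "\<And>t. t \<ge> N \<Longrightarrow> \<beta> r t < \<epsilon>" by (auto simp: eventually_at_top_linorder)
  then show ?thesis using that[of "max N 1"] by (simp add: less_imp_le)
qed

lemma \<beta>_small_radius:
  assumes "0 < \<epsilon>"
  obtains r where "0 < r" "r \<le> 1" "r \<le> \<epsilon>" "\<beta> r 0 \<le> \<epsilon>"
proof -
  have c: "continuous_on {0..} (\<lambda>r. \<beta> r 0)" and z: "\<beta> 0 0 = 0"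
    using KL by (auto simp: class_KL_def class_K_def)
  then obtain d where d: "d > 0" "\<And>r. r \<ge> 0 \<Longrightarrow> \<bar>r\<bar> < d \<Longrightarrow> \<bar>\<beta> r 0\<bar> < \<epsilon>"
    using assms unfolding continuous_on_iff by (force simp: dist_real_def)
  show ?thesis
  proof (rule that)
    let ?r = "min (d / 2) (min 1 \<epsilon>)"
    show "0 < ?r" "?r \<le> 1" "?r \<le> \<epsilon>" using d(1) assms by auto
    have "\<bar>?r\<bar> < d" "0 \<le> ?r" using d(1) assms by (auto simp: min_def)
    then show "\<beta> ?r 0 \<le> \<epsilon>" using d(2)[of ?r] by simp
  qed
qed

text \<open>The form in which the perturbation bound is used: on a window with little energy a trajectory
follows the decay of the unforced flow. Both radii in the perturbation bound are covered by \<open>R\<close>, since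
the unforced trajectory starting in the ball of radius \<open>r\<close> never exceeds \<open>\<beta> r 0\<close>.\<close>

lemma window_comparison:
  assumes "0 \<le> r" "0 < \<tau>" "0 < \<eta>"
  obtains e where "0 < e" "\<And>t0 x u t. \<lbrakk>0 \<le> t0; u \<in> U; norm x \<le> r;
      \<forall>t\<ge>t0. norm (\<phi> t t0 x u) \<le> r; w u t0 (t0 + \<tau>) \<le> e; t0 \<le> t; t \<le> t0 + \<tau>\<rbrakk>
      \<Longrightarrow> norm (\<phi> t t0 x u) \<le> \<beta> (norm x) (t - t0) + \<eta>"
proof -
  define R where "R = r + \<beta> r 0 + 1"
  have R: "R > 0" "r \<le> R" "\<beta> r 0 \<le> R"
    using assms \<beta>_nonneg[of r 0] by (auto simp: R_def)
  obtain C where C: "C \<ge> 0" and *: "\<And>t0 x u t. \<lbrakk>0 \<le> t0; u \<in> U;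
      \<forall>t\<in>{t0..t0 + \<tau>}. norm (\<phi> t t0 x u) \<le> R \<and> norm (\<phi> t t0 x zero) \<le> R; t \<in> {t0..t0 + \<tau>}\<rbrakk>
      \<Longrightarrow> norm (\<phi> t t0 x u - \<phi> t t0 x zero) \<le> \<eta> / 2 + C * w u t0 (t0 + \<tau>)"
    using perturbation[of R \<tau> "\<eta> / 2"] R assms by auto
  \<comment> \<open>Adding \<open>1\<close> avoids division by zero when \<open>C = 0\<close>.\<close>
  show ?thesis
  proof (rule that[of "\<eta> / (2 * (C + 1))"])
    show "0 < \<eta> / (2 * (C + 1))" using C assms by simp
    fix t0 t :: real and x :: 'x and u :: 'i
    assume h: "0 \<le> t0" "u \<in> U" "norm x \<le> r" "\<forall>t\<ge>t0. norm (\<phi> t t0 x u) \<le> r"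
      "w u t0 (t0 + \<tau>) \<le> \<eta> / (2 * (C + 1))" "t0 \<le> t" "t \<le> t0 + \<tau>"
    have "norm (\<phi> t t0 x zero) \<le> R" if "t0 \<le> t" for t
      using zero_decay[of t0 t x] \<beta>_mono[of "norm x" r 0 "t - t0"] h that R by auto
    then have "norm (\<phi> t t0 x u - \<phi> t t0 x zero) \<le> \<eta> / 2 + C * w u t0 (t0 + \<tau>)"
      using h R by (intro *) (auto intro: order_trans)
    also have "C * w u t0 (t0 + \<tau>) \<le> C * (\<eta> / (2 * (C + 1)))"
      using h C by (intro mult_left_mono) auto
    also have "\<dots> \<le> \<eta> / 2" using C assms by (simp add: field_simps)
    finally have "norm (\<phi> t t0 x u - \<phi> t t0 x zero) \<le> \<eta>" by simp
    then show "norm (\<phi> t t0 x u) \<le> \<beta> (norm x) (t - t0) + \<eta>"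
      using zero_decay[of t0 t x] h norm_triangle_sub[of "\<phi> t t0 x u" "\<phi> t t0 x zero"] by auto
  qed
qed

text \<open>Choose the window length \<open>\<tau>\<close> such that the unforced flow halves the radius \<open>d\<close> of a ball in time
\<open>\<tau>\<close>, and let the energy be so small that on every window the input adds at most \<open>d / 2\<close>. Then the ball
of radius \<open>d\<close> is reproduced at the end of each window, so the error does not accumulate although
the number of windows is unbounded. The a priori bound \<open>R\<close> makes the same constants valid on all windows.\<close>

lemma uniform_local_stability:
  assumes "0 < \<epsilon>"
  obtains \<delta> where "0 < \<delta>" "\<And>t0 t x u. \<lbrakk>0 \<le> t0; t0 \<le> t; u \<in> U; norm x \<le> \<delta>; en u \<le> \<delta>\<rbrakk>
      \<Longrightarrow> norm (\<phi> t t0 x u) \<le> \<epsilon>"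
proof -
  obtain R where R: "\<And>t0 t x u. \<lbrakk>0 \<le> t0; t0 \<le> t; u \<in> U; norm x \<le> 1; en u \<le> 1\<rbrakk>
      \<Longrightarrow> norm (\<phi> t t0 x u) \<le> R" using bounded[of 1] by blast
  obtain d where d: "0 < d" "d \<le> 1" "d \<le> \<epsilon> / 2" "\<beta> d 0 \<le> \<epsilon> / 2"
    using \<beta>_small_radius[of "\<epsilon> / 2"] assms by auto
  obtain \<tau> where \<tau>: "0 < \<tau>" "\<beta> d \<tau> \<le> d / 2"
    using \<beta>_small_time[of d "d / 2"] d by auto
  obtain e where e: "0 < e" and cmp: "\<And>t0 x u t. \<lbrakk>0 \<le> t0; u \<in> U; norm x \<le> max R 1;
      \<forall>t\<ge>t0. norm (\<phi> t t0 x u) \<le> max R 1; w u t0 (t0 + \<tau>) \<le> e; t0 \<le> t; t \<le> t0 + \<tau>\<rbrakk>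
      \<Longrightarrow> norm (\<phi> t t0 x u) \<le> \<beta> (norm x) (t - t0) + d / 2"
    by (rule window_comparison[of "max R 1" \<tau> "d / 2"]) (use \<tau> d in auto)
  show ?thesis
  proof (rule that[of "min d e"])
    fix t0 t :: real and x :: 'x and u :: 'i
    assume h: "0 \<le> t0" "t0 \<le> t" "u \<in> U" "norm x \<le> min d e" "en u \<le> min d e"
    define s where "s k = t0 + real k * \<tau>" for k
    have s0: "t0 \<le> s k" for k using \<tau> by (simp add: s_def)
    have window: "norm (\<phi> r t0 x u) \<le> \<beta> d (r - s k) + d / 2"
      if ih: "norm (\<phi> (s k) t0 x u) \<le> d" and r: "s k \<le> r" "r \<le> s k + \<tau>" for k r
    proof -
      let ?y = "\<phi> (s k) t0 x u"
      have "norm (\<phi> t' (s k) ?y u) \<le> R" if "t' \<ge> s k" for t'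
        using cocycle[of t0 "s k" t' u x] R[of t0 t' u x] h s0[of k] that d by auto
      then have "norm (\<phi> r (s k) ?y u) \<le> \<beta> (norm ?y) (r - s k) + d / 2"
        using h s0[of k] r window_le[of "s k" "s k + \<tau>" u] \<tau> ih d
        by (intro cmp) (auto intro: max.coboundedI1)
      also have "\<dots> \<le> \<beta> d (r - s k) + d / 2"
        using \<beta>_mono[of "norm ?y" d "r - s k" "r - s k"] ih r by auto
      finally show ?thesis using cocycle[of t0 "s k" r u x] h s0[of k] r by simp
    qed
    have small: "norm (\<phi> (s k) t0 x u) \<le> d" for k
    proof (induction k)
      case 0
      then show ?case using initial[of t0 u x] h by (simp add: s_def)
    next
      case (Suc k)
      have "norm (\<phi> (s (Suc k)) t0 x u) \<le> \<beta> d (s (Suc k) - s k) + d / 2"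
        using \<tau> by (intro window Suc) (auto simp: s_def algebra_simps)
      also have "s (Suc k) - s k = \<tau>" by (simp add: s_def algebra_simps)
      finally show ?case using \<tau> by simp
    qed
    \<comment> \<open>The number of the window that contains \<open>t\<close>.\<close>
    define k where "k = nat \<lfloor>(t - t0) / \<tau>\<rfloor>"
    have "real k \<le> (t - t0) / \<tau>" "(t - t0) / \<tau> < real k + 1"
      using h \<tau> by (auto simp: k_def)
    then have k: "s k \<le> t" "t \<le> s k + \<tau>"
      using \<tau> by (auto simp: s_def field_simps)
    have "norm (\<phi> t t0 x u) \<le> \<beta> d (t - s k) + d / 2"
      using k small by (intro window) auto
    also have "\<beta> d (t - s k) \<le> \<beta> d 0" using k d by (intro \<beta>_mono) auto
    finally show "norm (\<phi> t t0 x u) \<le> \<epsilon>" using d by simp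
  qed (use d e in auto)
qed


text \<open>The largest norm reached from initial states of norm at most \<open>r\<close> with energy at most \<open>r\<close>; the
element \<open>0\<close> keeps the supremum well behaved for negative \<open>r\<close>. It is finite by uniform boundedness and
tends to \<open>0\<close> at \<open>0\<close> by local stability.\<close>

definition gain :: "real \<Rightarrow> real" where
  "gain r = Sup (insert 0 {norm (\<phi> t t0 x u) | t t0 x u.
     0 \<le> t0 \<and> t0 \<le> t \<and> u \<in> U \<and> norm x \<le> r \<and> en u \<le> r})"

lemma gain_bdd:
  "bdd_above (insert 0 {norm (\<phi> t t0 x u) | t t0 x u.
     0 \<le> t0 \<and> t0 \<le> t \<and> u \<in> U \<and> norm x \<le> r \<and> en u \<le> r})"
proof -
  obtain R where "\<forall>t0\<ge>0. \<forall>t\<ge>t0. \<forall>x. \<forall>u\<in>U. norm x \<le> r \<longrightarrow> en u \<le> r \<longrightarrow> norm (\<phi> t t0 x u) \<le> R"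
    using bounded[of r] by blast
  then show ?thesis by (intro bdd_aboveI[of _ "max 0 R"]) (auto intro: max.coboundedI2)
qed

lemma gain_upper:
  "\<lbrakk>0 \<le> t0; t0 \<le> t; u \<in> U; norm x \<le> r; en u \<le> r\<rbrakk> \<Longrightarrow> norm (\<phi> t t0 x u) \<le> gain r"
  unfolding gain_def by (rule cSup_upper[OF _ gain_bdd]) blast

lemma gain_nonneg: "0 \<le> gain r"
  unfolding gain_def by (rule cSup_upper[OF _ gain_bdd]) simp

lemma gain_mono: "r \<le> r' \<Longrightarrow> gain r \<le> gain r'"
  unfolding gain_def by (rule cSup_subset_mono[OF _ gain_bdd]) (auto, force)

lemma gain_small:
  assumes "0 < \<epsilon>"
  obtains \<delta> where "0 < \<delta>" "gain \<delta> \<le> \<epsilon>"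
proof -
  obtain \<delta> where \<delta>: "0 < \<delta>" and *: "\<And>t0 t x u. \<lbrakk>0 \<le> t0; t0 \<le> t; u \<in> U; norm x \<le> \<delta>; en u \<le> \<delta>\<rbrakk>
      \<Longrightarrow> norm (\<phi> t t0 x u) \<le> \<epsilon>"
    by (rule uniform_local_stability[OF assms]) auto
  have "gain \<delta> \<le> \<epsilon>"
    unfolding gain_def by (rule cSup_least) (use * assms in auto)
  with \<delta> show ?thesis by (rule that)
qed

lemma gain_zero: "gain 0 = 0"
proof (rule antisym)
  show "gain 0 \<le> 0"
  proof (rule field_le_epsilon)
    fix \<epsilon> :: real assume "0 < \<epsilon>"
    then obtain \<delta> where "0 < \<delta>" "gain \<delta> \<le> \<epsilon>" by (rule gain_small)
    then show "gain 0 \<le> 0 + \<epsilon>" using gain_mono[of 0 \<delta>] by simp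
  qed
qed (rule gain_nonneg)

lemma gain_tendsto_0: "(gain \<longlongrightarrow> 0) (at_right 0)"
proof (rule tendstoI)
  fix \<epsilon> :: real assume "0 < \<epsilon>"
  obtain \<delta> where \<delta>: "0 < \<delta>" "gain \<delta> \<le> \<epsilon> / 2"
    by (rule gain_small[of "\<epsilon> / 2"]) (use \<open>0 < \<epsilon>\<close> in auto)
  have "\<forall>\<^sub>F r in at_right 0. r < \<delta>"
    using \<delta> by (auto simp: eventually_at_right_field)
  then show "\<forall>\<^sub>F r in at_right 0. dist (gain r) 0 < \<epsilon>"
  proof (rule eventually_mono)
    fix r assume "r < \<delta>"
    then have "gain r \<le> \<epsilon> / 2" using gain_mono[of r \<delta>] \<delta> by simp
    then show "dist (gain r) 0 < \<epsilon>" using gain_nonneg[of r] \<open>0 < \<epsilon>\<close> by (simp add: dist_real_def)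
  qed
qed

lemma norm_le_gain_sum:
  assumes "0 \<le> t0" "t0 \<le> t" "u \<in> U" "norm x \<le> r"
  shows "norm (\<phi> t t0 x u) \<le> gain r + gain (en u)"
proof -
  have "norm (\<phi> t t0 x u) \<le> gain (max r (en u))"
    using assms by (intro gain_upper) auto
  then show ?thesis using gain_nonneg[of r] gain_nonneg[of "en u"] by (auto simp: max_def split: if_splits)
qed

lemma window_sum_ge:
  assumes "0 \<le> t0" "0 < \<tau>" "u \<in> U" "\<And>k. k < n \<Longrightarrow> e < w u (t0 + real k * \<tau>) (t0 + real (Suc k) * \<tau>)"
  shows "real n * e \<le> w u t0 (t0 + real n * \<tau>)"
  using assms(4)
proof (induction n)
  case 0
  have "w u t0 t0 = 0" using window_add[of t0 t0 t0 u] assms by simp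
  then show ?case by simp
next
  case (Suc n)
  have "w u t0 (t0 + real (Suc n) * \<tau>) =
      w u t0 (t0 + real n * \<tau>) + w u (t0 + real n * \<tau>) (t0 + real (Suc n) * \<tau>)"
    using assms by (intro window_add) (auto simp: mult_right_mono)
  moreover have "real n * e \<le> w u t0 (t0 + real n * \<tau>)" using Suc.prems by (intro Suc.IH) simp
  ultimately show ?case using Suc.prems[of n] by (simp add: algebra_simps)
qed

text \<open>Pigeonhole: the total energy is at most \<open>r\<close>, so among \<open>n > r / e\<close> consecutive windows one carries
energy at most \<open>e\<close>, and during that window the trajectory contracts to the prescribed radius. Only the
bound \<open>r\<close> on the energy enters the time \<open>\<theta>\<close>, not the input.\<close>

lemma uniform_reach:
  assumes "0 \<le> r" "0 < \<delta>"
  obtains \<theta> where "0 \<le> \<theta>" "\<And>t0 x u. \<lbrakk>0 \<le> t0; u \<in> U; norm x \<le> r; en u \<le> r\<rbrakk>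
      \<Longrightarrow> \<exists>t\<in>{t0..t0 + \<theta>}. norm (\<phi> t t0 x u) \<le> \<delta>"
proof -
  define R where "R = gain r"
  have R: "R \<ge> 0" by (simp add: R_def gain_nonneg)
  obtain \<tau> where \<tau>: "0 < \<tau>" "\<beta> R \<tau> \<le> \<delta> / 2"
    by (rule \<beta>_small_time[of R "\<delta> / 2"]) (use R assms in auto)
  obtain e where e: "0 < e" and cmp: "\<And>t0 x u t. \<lbrakk>0 \<le> t0; u \<in> U; norm x \<le> R;
      \<forall>t\<ge>t0. norm (\<phi> t t0 x u) \<le> R; w u t0 (t0 + \<tau>) \<le> e; t0 \<le> t; t \<le> t0 + \<tau>\<rbrakk>
      \<Longrightarrow> norm (\<phi> t t0 x u) \<le> \<beta> (norm x) (t - t0) + \<delta> / 2"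
    by (rule window_comparison[of R \<tau> "\<delta> / 2"]) (use R \<tau> assms in auto)
  obtain n :: nat where n: "r < real n * e" using e ex_less_of_nat_mult by blast
  show ?thesis
  proof (rule that[of "real n * \<tau>"])
    show "0 \<le> real n * \<tau>" using \<tau> by simp
    fix t0 :: real and x :: 'x and u :: 'i
    assume h: "0 \<le> t0" "u \<in> U" "norm x \<le> r" "en u \<le> r"
    have "\<exists>k<n. w u (t0 + real k * \<tau>) (t0 + real (Suc k) * \<tau>) \<le> e"
    proof (rule ccontr)
      assume "\<not> ?thesis"
      then have "real n * e \<le> w u t0 (t0 + real n * \<tau>)"
        using h \<tau> by (intro window_sum_ge) auto
      also have "\<dots> \<le> en u" using h \<tau> by (intro window_le) auto
      finally show False using n h by simp
    qed
    then obtain k where k: "k < n" "w u (t0 + real k * \<tau>) (t0 + real (Suc k) * \<tau>) \<le> e" by blast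
    define s where "s = t0 + real k * \<tau>"
    have s: "t0 \<le> s" "0 \<le> s" "t0 + real (Suc k) * \<tau> = s + \<tau>"
      using \<tau> h by (auto simp: s_def algebra_simps)
    let ?y = "\<phi> s t0 x u"
    have y: "norm ?y \<le> R" using h s gain_upper[of t0 s u x r] by (simp add: R_def)
    have "norm (\<phi> t s ?y u) \<le> R" if "t \<ge> s" for t
      using that h s gain_upper[of t0 t u x r] cocycle[of t0 s t u x] by (simp add: R_def)
    then have "norm (\<phi> (s + \<tau>) s ?y u) \<le> \<beta> (norm ?y) (s + \<tau> - s) + \<delta> / 2"
      using h s k y \<tau> by (intro cmp) (auto simp: s_def[symmetric])
    also have "\<beta> (norm ?y) (s + \<tau> - s) \<le> \<beta> R \<tau>" using y \<tau> by (intro \<beta>_mono) auto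
    finally have "norm (\<phi> (s + \<tau>) t0 x u) \<le> \<delta>"
      using \<tau> h s cocycle[of t0 s "s + \<tau>" u x] by simp
    moreover have "real (Suc k) * \<tau> \<le> real n * \<tau>" using k \<tau> by (intro mult_right_mono) auto
    then have "s + \<tau> \<in> {t0..t0 + real n * \<tau>}" using s \<tau> by (auto simp flip: s(3))
    ultimately show "\<exists>t\<in>{t0..t0 + real n * \<tau>}. norm (\<phi> t t0 x u) \<le> \<delta>" by blast
  qed
qed

text \<open>The transient time must not depend on the energy, which is unbounded. If the energy is at most \<open>r\<close>, the
trajectory reaches a small ball in uniform time and is restarted there; if it exceeds \<open>r\<close>, there is
nothing to wait for.\<close>

lemma uniform_asymptotic_gain:
  assumes "0 \<le> r" "0 < \<epsilon>"
  obtains \<theta> where "0 \<le> \<theta>" "\<And>t0 t x u. \<lbrakk>0 \<le> t0; t0 + \<theta> \<le> t; u \<in> U; norm x \<le> r\<rbrakk>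
      \<Longrightarrow> norm (\<phi> t t0 x u) \<le> \<epsilon> + gain (en u)"
proof -
  obtain \<delta> where \<delta>: "0 < \<delta>" "gain \<delta> \<le> \<epsilon>" using gain_small[OF assms(2)] .
  obtain \<theta> where \<theta>: "0 \<le> \<theta>" and reach: "\<And>t0 x u. \<lbrakk>0 \<le> t0; u \<in> U; norm x \<le> r; en u \<le> r\<rbrakk>
      \<Longrightarrow> \<exists>t\<in>{t0..t0 + \<theta>}. norm (\<phi> t t0 x u) \<le> \<delta>"
    by (rule uniform_reach[OF assms(1) \<delta>(1)]) auto
  show ?thesis
  proof (rule that[OF \<theta>])
    fix t0 t :: real and x :: 'x and u :: 'i
    assume h: "0 \<le> t0" "t0 + \<theta> \<le> t" "u \<in> U" "norm x \<le> r"
    show "norm (\<phi> t t0 x u) \<le> \<epsilon> + gain (en u)"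
    proof (cases "en u \<le> r")
      case True
      then obtain s where s: "t0 \<le> s" "s \<le> t0 + \<theta>" "norm (\<phi> s t0 x u) \<le> \<delta>"
        using reach[of t0 u x] h by auto
      then have "norm (\<phi> t s (\<phi> s t0 x u) u) \<le> gain \<delta> + gain (en u)"
        using h by (intro norm_le_gain_sum) auto
      then show ?thesis using cocycle[of t0 s t u x] s h \<delta> by simp
    next
      case False
      \<comment> \<open>The energy dominates the initial state, so the gain alone bounds the whole trajectory.\<close>
      then show ?thesis using gain_upper[of t0 t u x "en u"] h \<theta> assms by simp
    qed
  qed
qed

text \<open>What is left of the trajectories from the ball of radius \<open>r\<close> after time \<open>\<theta>\<close>, beyond the part explained by
the energy. After averaging in \<open>r\<close> this becomes the \<open>KL\<close> function of the iISS estimate.\<close>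

definition residual :: "real \<Rightarrow> real \<Rightarrow> real" where
  "residual r \<theta> = Sup (insert 0 {norm (\<phi> t t0 x u) - gain (en u) | t t0 x u.
     0 \<le> t0 \<and> t0 + \<theta> \<le> t \<and> u \<in> U \<and> norm x \<le> r})"

lemma residual_bdd:
  assumes "0 \<le> \<theta>"
  shows "bdd_above (insert 0 {norm (\<phi> t t0 x u) - gain (en u) | t t0 x u.
     0 \<le> t0 \<and> t0 + \<theta> \<le> t \<and> u \<in> U \<and> norm x \<le> r})"
proof -
  have "norm (\<phi> t t0 x u) - gain (en u) \<le> gain r"
    if "0 \<le> t0" "t0 + \<theta> \<le> t" "u \<in> U" "norm x \<le> r" for t t0 x u
    using norm_le_gain_sum[of t0 t u x r] that assms by simp
  then show ?thesis using gain_nonneg by (intro bdd_aboveI[of _ "gain r"]) auto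
qed

lemma residual_upper:
  assumes "0 \<le> \<theta>" "0 \<le> t0" "t0 + \<theta> \<le> t" "u \<in> U" "norm x \<le> r"
  shows "norm (\<phi> t t0 x u) \<le> residual r \<theta> + gain (en u)"
proof -
  have "norm (\<phi> t t0 x u) - gain (en u) \<le> residual r \<theta>"
    unfolding residual_def by (rule cSup_upper[OF _ residual_bdd]) (use assms in blast)+
  then show ?thesis by simp
qed

lemma residual_nonneg: "0 \<le> \<theta> \<Longrightarrow> 0 \<le> residual r \<theta>"
  unfolding residual_def by (rule cSup_upper[OF _ residual_bdd]) auto

lemma residual_least:
  assumes "0 \<le> B" "\<And>t t0 x u. \<lbrakk>0 \<le> t0; t0 + \<theta> \<le> t; u \<in> U; norm x \<le> r\<rbrakk>
      \<Longrightarrow> norm (\<phi> t t0 x u) \<le> B + gain (en u)"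
  shows "residual r \<theta> \<le> B"
  unfolding residual_def by (rule cSup_least) (use assms in \<open>force simp: algebra_simps\<close>)+

lemma residual_mono: "\<lbrakk>r \<le> r'; 0 \<le> \<theta>'; \<theta>' \<le> \<theta>\<rbrakk> \<Longrightarrow> residual r \<theta> \<le> residual r' \<theta>'"
  by (intro residual_least residual_nonneg residual_upper) auto

lemma residual_le_gain: "0 \<le> \<theta> \<Longrightarrow> residual r \<theta> \<le> gain r"
  by (intro residual_least gain_nonneg norm_le_gain_sum) auto

lemma residual_tendsto_0:
  assumes "0 \<le> r"
  shows "(residual r \<longlongrightarrow> 0) at_top"
proof (rule tendstoI)
  fix \<epsilon> :: real assume "0 < \<epsilon>"
  obtain \<theta> where \<theta>: "0 \<le> \<theta>" "\<And>t0 t x u. \<lbrakk>0 \<le> t0; t0 + \<theta> \<le> t; u \<in> U; norm x \<le> r\<rbrakk>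
      \<Longrightarrow> norm (\<phi> t t0 x u) \<le> \<epsilon> / 2 + gain (en u)"
    by (rule uniform_asymptotic_gain[OF assms, of "\<epsilon> / 2"]) (use \<open>0 < \<epsilon>\<close> in auto)
  have "\<bar>residual r t\<bar> < \<epsilon>" if "t \<ge> \<theta>" for t
  proof -
    have "residual r t \<le> \<epsilon> / 2" using \<theta> that \<open>0 < \<epsilon>\<close> by (intro residual_least) auto
    then show ?thesis using residual_nonneg[of t r] that \<theta> \<open>0 < \<epsilon>\<close> by auto
  qed
  then show "\<forall>\<^sub>F t in at_top. dist (residual r t) 0 < \<epsilon>"
    unfolding eventually_at_top_linorder by (auto simp: dist_real_def)
qed

theorem iISS_estimate:
  "\<exists>b \<rho>. class_KL b \<and> class_Kinf \<rho> \<and> (\<forall>t0\<ge>0. \<forall>t\<ge>t0. \<forall>x. \<forall>u\<in>U.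
     norm (\<phi> t t0 x u) \<le> b (norm x) (t - t0) + \<rho> (en u))"
proof -
  define b where "b r \<theta> = dilation_mean (\<lambda>s. residual s \<theta>) r + exp (- \<theta>) * r" for r \<theta>
  define \<rho> where "\<rho> r = dilation_mean gain r + r" for r
  have gm: "mono_on {0..} gain" by (auto intro: mono_onI gain_mono)
  have rm: "mono_on {0..} (\<lambda>s. residual s \<theta>)" if "0 \<le> \<theta>" for \<theta>
    using that by (auto intro: mono_onI residual_mono)
  have "class_K (\<lambda>r. b r \<theta>)" if "0 \<le> \<theta>" for \<theta>
    unfolding b_def
  proof (rule class_K_dilation_mean_plus[OF rm[OF that]])
    show "((\<lambda>s. residual s \<theta>) \<longlongrightarrow> 0) (at_right 0)"
      by (rule tendsto_sandwich[OF _ _ tendsto_const gain_tendsto_0])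
        (use that in \<open>auto intro!: always_eventually residual_nonneg residual_le_gain\<close>)
    show "residual 0 \<theta> = 0"
      using residual_nonneg[of \<theta> 0] residual_le_gain[of \<theta> 0] gain_zero that by simp
  qed simp
  moreover have "antimono_on {0..} (b r)" if "0 \<le> r" for r
    unfolding b_def using that
    by (intro monotone_onI add_mono dilation_mean_mono mult_right_mono rm residual_mono) auto
  moreover have "(b r \<longlongrightarrow> 0) at_top" if "0 \<le> r" for r
  proof (rule tendsto_sandwich[OF _ _ tendsto_const])
    show "\<forall>\<^sub>F \<theta> in at_top. 0 \<le> b r \<theta>"
      using eventually_ge_at_top[of 0]
    proof (rule eventually_mono)
      fix \<theta> :: real assume "0 \<le> \<theta>"
      then show "0 \<le> b r \<theta>"
        using dilation_mean_ge[OF rm that, of \<theta>] residual_nonneg[of \<theta> r] that by (simp add: b_def)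
    qed
    show "\<forall>\<^sub>F \<theta> in at_top. b r \<theta> \<le> residual (2 * r) \<theta> + exp (- \<theta>) * r"
      using eventually_ge_at_top[of 0]
      by (rule eventually_mono) (use dilation_mean_le[OF rm that] in \<open>simp add: b_def\<close>)
    have "((\<lambda>\<theta>::real. exp (- \<theta>)) \<longlongrightarrow> 0) at_top"
      by (intro filterlim_compose[OF exp_at_bot] filterlim_uminus_at_bot_at_top)
    then have "((\<lambda>\<theta>. residual (2 * r) \<theta> + exp (- \<theta>) * r) \<longlongrightarrow> 0 + 0 * r) at_top"
      using that by (intro tendsto_intros residual_tendsto_0) auto
    then show "((\<lambda>\<theta>. residual (2 * r) \<theta> + exp (- \<theta>) * r) \<longlongrightarrow> 0) at_top" by simp
  qed
  ultimately have "class_KL b" by (simp add: class_KL_def)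
  moreover have "class_Kinf \<rho>"
    unfolding \<rho>_def by (intro class_Kinf_dilation_mean_plus_id gm gain_tendsto_0 gain_zero)
  moreover have "norm (\<phi> t t0 x u) \<le> b (norm x) (t - t0) + \<rho> (en u)"
    if h: "0 \<le> t0" "t0 \<le> t" "u \<in> U" for t t0 x u
  proof -
    have "norm (\<phi> t t0 x u) \<le> residual (norm x) (t - t0) + gain (en u)"
      using h by (intro residual_upper) auto
    also have "residual (norm x) (t - t0) \<le> b (norm x) (t - t0)"
      using dilation_mean_ge[OF rm, of "t - t0" "norm x"] h by (simp add: b_def add_increasing2)
    also have "gain (en u) \<le> \<rho> (en u)"
      using dilation_mean_ge[OF gm energy_nonneg] energy_nonneg[of u] h by (simp add: \<rho>_def add_increasing2)
    finally show ?thesis by simp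
  qed
  ultimately show ?thesis by blast
qed

end

section \<open>Regulated functions\<close>

text \<open>Piecewise continuity enters only through the existence of one-sided limits; in contrast to the
finiteness of the set of discontinuities, this property is visibly stable under all compositions
that occur in the variation of constants formula.\<close>

definition regulated_on :: "real \<Rightarrow> real \<Rightarrow> (real \<Rightarrow> 'a::topological_space) \<Rightarrow> bool" where
  "regulated_on a b h \<longleftrightarrow> (\<forall>s\<in>{a..<b}. \<exists>l. (h \<longlongrightarrow> l) (at_right s)) \<and>
     (\<forall>s\<in>{a<..b}. \<exists>l. (h \<longlongrightarrow> l) (at_left s))"

text \<open>On either side of each point a regulated function is within \<open>\<epsilon>\<close> of a constant. This local
fact becomes global on compact intervals by bisection.\<close>

lemma regulated_on_local:
  fixes h :: "real \<Rightarrow> 'a::metric_space"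
  assumes "regulated_on a b h" "a \<le> x" "x \<le> b" "0 < \<epsilon>"
  obtains d l r where "0 < d" "\<And>y. \<lbrakk>a \<le> y; y < x; x - d < y\<rbrakk> \<Longrightarrow> dist (h y) l < \<epsilon>"
    "\<And>y. \<lbrakk>y \<le> b; x < y; y < x + d\<rbrakk> \<Longrightarrow> dist (h y) r < \<epsilon>"
proof -
  have "\<exists>l d. d > 0 \<and> (\<forall>y. a \<le> y \<longrightarrow> y < x \<longrightarrow> x - d < y \<longrightarrow> dist (h y) l < \<epsilon>)"
  proof (cases "a < x")
    case True
    then obtain l where "(h \<longlongrightarrow> l) (at_left x)"
      using assms unfolding regulated_on_def by (metis greaterThanAtMost_iff)
    then have "\<forall>\<^sub>F y in at_left x. dist (h y) l < \<epsilon>" using assms tendstoD by blast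
    then obtain c where "c < x" "\<And>y. c < y \<Longrightarrow> y < x \<Longrightarrow> dist (h y) l < \<epsilon>"
      by (auto simp: eventually_at_left_field)
    then show ?thesis by (intro exI[of _ l] exI[of _ "x - c"]) auto
  qed (use assms in \<open>auto intro!: exI[of _ 1]\<close>)
  moreover have "\<exists>r d. d > 0 \<and> (\<forall>y. y \<le> b \<longrightarrow> x < y \<longrightarrow> y < x + d \<longrightarrow> dist (h y) r < \<epsilon>)"
  proof (cases "x < b")
    case True
    then obtain l where "(h \<longlongrightarrow> l) (at_right x)"
      using assms unfolding regulated_on_def by (metis atLeastLessThan_iff)
    then have "\<forall>\<^sub>F y in at_right x. dist (h y) l < \<epsilon>" using assms tendstoD by blast
    then obtain c where "c > x" "\<And>y. x < y \<Longrightarrow> y < c \<Longrightarrow> dist (h y) l < \<epsilon>"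
      by (auto simp: eventually_at_right_field)
    then show ?thesis by (intro exI[of _ l] exI[of _ "c - x"]) auto
  qed (use assms in \<open>auto intro!: exI[of _ 1]\<close>)
  ultimately obtain l r d d' where "d > 0" "d' > 0"
    "\<And>y. a \<le> y \<Longrightarrow> y < x \<Longrightarrow> x - d < y \<Longrightarrow> dist (h y) l < \<epsilon>"
    "\<And>y. y \<le> b \<Longrightarrow> x < y \<Longrightarrow> y < x + d' \<Longrightarrow> dist (h y) r < \<epsilon>" by auto
  then show ?thesis by (intro that[of "min d d'" l r]) auto
qed

lemma regulated_on_bounded:
  fixes h :: "real \<Rightarrow> 'a::real_normed_vector"
  assumes "regulated_on a b h" "a \<le> b"
  obtains B where "\<And>x. x \<in> {a..b} \<Longrightarrow> norm (h x) \<le> B"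
proof -
  have "\<exists>B. \<forall>x\<in>{a..b} \<inter> {a..b}. norm (h x) \<le> B"
    using \<open>a \<le> b\<close>
  proof (induction rule: Bolzano[where P = "\<lambda>c d. \<exists>B. \<forall>x\<in>{c..d} \<inter> {a..b}. norm (h x) \<le> B"])
    case (trans c d e)
    then obtain B B' where "\<forall>x\<in>{c..d} \<inter> {a..b}. norm (h x) \<le> B" "\<forall>x\<in>{d..e} \<inter> {a..b}. norm (h x) \<le> B'"
      by auto
    then show ?case
      by (intro exI[of _ "max B B'"]) (force simp: le_max_iff_disj)
  next
    case (local x)
    obtain d l r where d: "0 < d" "\<And>y. \<lbrakk>a \<le> y; y < x; x - d < y\<rbrakk> \<Longrightarrow> dist (h y) l < 1"
      "\<And>y. \<lbrakk>y \<le> b; x < y; y < x + d\<rbrakk> \<Longrightarrow> dist (h y) r < 1"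
      using regulated_on_local[OF assms(1) local, of 1] by auto
    have "norm (h y) \<le> norm l + norm r + norm (h x) + 1"
      if "c \<le> x" "x \<le> e" "e - c < d" "y \<in> {c..e} \<inter> {a..b}" for c e y
    proof -
      consider "y < x" | "y = x" | "y > x" by linarith
      then show ?thesis
      proof cases
        case 1
        then have "norm (h y - l) < 1" using d(2)[of y] that by (auto simp: dist_norm)
        then show ?thesis using norm_triangle_sub[of "h y" l] norm_ge_zero[of r] norm_ge_zero[of "h x"] by linarith
      next
        case 3
        then have "norm (h y - r) < 1" using d(3)[of y] that by (auto simp: dist_norm)
        then show ?thesis using norm_triangle_sub[of "h y" r] norm_ge_zero[of l] norm_ge_zero[of "h x"] by linarith
      qed auto
    qed
    then show ?case using d(1) by blast
  qed
  then show ?thesis using that by fastforce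
qed

lemma regulated_on_integrable:
  fixes h :: "real \<Rightarrow> 'a::banach"
  assumes "regulated_on a b h"
  shows "h integrable_on {a..b}"
proof (cases "a \<le> b")
  case True
  have "\<exists>g. (\<forall>x\<in>cbox a b. norm (h x - g x) \<le> \<epsilon>) \<and> g integrable_on cbox a b" if eps: "0 < \<epsilon>" for \<epsilon>
  proof -
    have "\<exists>g. (\<forall>x\<in>{a..b} \<inter> {a..b}. norm (h x - g x) \<le> \<epsilon>) \<and> g integrable_on {a..b}"
      using \<open>a \<le> b\<close>
    proof (induction rule: Bolzano[where P = "\<lambda>c d. \<exists>g. (\<forall>x\<in>{c..d} \<inter> {a..b}. norm (h x - g x) \<le> \<epsilon>)
        \<and> g integrable_on {c..d}"])
      case (trans c d e)
      then obtain g g' where g: "\<forall>x\<in>{c..d} \<inter> {a..b}. norm (h x - g x) \<le> \<epsilon>" "g integrable_on {c..d}"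
        and g': "\<forall>x\<in>{d..e} \<inter> {a..b}. norm (h x - g' x) \<le> \<epsilon>" "g' integrable_on {d..e}" by auto
      let ?g = "\<lambda>x. if x \<le> d then g x else g' x"
      have "?g integrable_on {c..d}" by (rule integrable_eq[OF g(2)]) auto
      moreover have "?g integrable_on {d..e}"
        by (rule integrable_spike_finite[OF _ _ g'(2), of "{d}"]) auto
      ultimately have "?g integrable_on {c..e}"
        by (rule Henstock_Kurzweil_Integration.integrable_combine[OF trans(3,4)])
      then show ?case using g(1) g'(1) by (intro exI[of _ ?g]) auto
    next
      case (local x)
      obtain d l r where d: "0 < d" "\<And>y. \<lbrakk>a \<le> y; y < x; x - d < y\<rbrakk> \<Longrightarrow> dist (h y) l < \<epsilon>"
        "\<And>y. \<lbrakk>y \<le> b; x < y; y < x + d\<rbrakk> \<Longrightarrow> dist (h y) r < \<epsilon>"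
        by (rule regulated_on_local[OF assms local eps]) blast
      let ?g = "\<lambda>y. if y < x then l else if y = x then h x else r"
      have "\<exists>g. (\<forall>y\<in>{c..e} \<inter> {a..b}. norm (h y - g y) \<le> \<epsilon>) \<and> g integrable_on {c..e}"
        if ce: "c \<le> x" "x \<le> e" "e - c < d" for c e
      proof (intro exI[of _ ?g] conjI)
        show "\<forall>y\<in>{c..e} \<inter> {a..b}. norm (h y - ?g y) \<le> \<epsilon>"
        proof
          fix y assume "y \<in> {c..e} \<inter> {a..b}"
          then show "norm (h y - ?g y) \<le> \<epsilon>"
            using less_imp_le[OF d(2)[of y]] less_imp_le[OF d(3)[of y]] ce eps by (auto simp: dist_norm)
        qed
        have "?g integrable_on {c..x}"
          by (rule integrable_spike_finite[where S = "{x}" and f = "\<lambda>_. l"]) auto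
        moreover have "?g integrable_on {x..e}"
          by (rule integrable_spike_finite[where S = "{x}" and f = "\<lambda>_. r"]) auto
        ultimately show "?g integrable_on {c..e}"
          by (rule Henstock_Kurzweil_Integration.integrable_combine[OF ce(1,2)])
      qed
      with d(1) show ?case by blast
    qed
    then show ?thesis by simp
  qed
  then show ?thesis using integrable_uniform_limit[of a b h] by simp
qed (auto intro: integrable_on_empty)

section \<open>Bochner integrals of regulated functions\<close>

lemma simple_bochner_integral_has_integral:
  fixes s :: "real \<Rightarrow> 'a::real_normed_vector"
  assumes "Bochner_Integration.simple_bochner_integrable (lebesgue_on {a..b}) s"
  shows "(s has_integral Bochner_Integration.simple_bochner_integral (lebesgue_on {a..b}) s) {a..b}"
proof -
  let ?M = "lebesgue_on {a..b}"
  let ?A = "\<lambda>y. {x \<in> {a..b}. s x = y}"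
  have sf: "simple_function ?M s" using assms by (auto elim: simple_bochner_integrable.cases)
  then have fin: "finite (s ` {a..b})" by (auto simp: simple_function_def)
  have "((\<lambda>x. indicator (?A y) x *\<^sub>R y) has_integral measure ?M (?A y) *\<^sub>R y) {a..b}" if "y \<in> s ` {a..b}" for y
  proof (rule has_integral_scaleR_left)
    have "?A y \<in> sets ?M"
      using simple_functionD(2)[OF sf, of "{y}"] by (simp add: vimage_def Int_def conj_commute)
    then have leb: "?A y \<in> sets lebesgue" by (auto simp: sets_restrict_space_iff)
    have lm: "?A y \<in> lmeasurable"
      by (rule bounded_set_imp_lmeasurable[OF _ leb]) (rule bounded_subset[of "{a..b}"], auto)
    have "measure ?M (?A y) = measure lebesgue (?A y)"
      by (intro measure_restrict_space) auto
    moreover have "((\<lambda>x. indicator (?A y) x :: real) has_integral measure lebesgue (?A y)) {a..b}"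
    proof -
      have "(indicat_real (?A y) has_integral measure lebesgue (?A y)) UNIV"
        using lmeasurable_iff_indicator_has_integral lm by blast
      then have "((\<lambda>x. if x \<in> {a..b} then indicat_real (?A y) x else 0) has_integral
          measure lebesgue (?A y)) UNIV"
        by (rule has_integral_eq[rotated]) (auto simp: indicator_def)
      then show ?thesis by (simp only: has_integral_restrict_UNIV)
    qed
    ultimately show "((indicator (?A y) :: real \<Rightarrow> real) has_integral measure ?M (?A y)) {a..b}" by simp
  qed
  then have "((\<lambda>x. \<Sum>y\<in>s ` {a..b}. indicator (?A y) x *\<^sub>R y) has_integral
      (\<Sum>y\<in>s ` {a..b}. measure ?M (?A y) *\<^sub>R y)) {a..b}"
    by (intro has_integral_sum fin)
  then have "(s has_integral (\<Sum>y\<in>s ` {a..b}. measure ?M (?A y) *\<^sub>R y)) {a..b}"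
  proof (rule has_integral_eq[rotated])
    fix x assume "x \<in> {a..b}"
    then show "(\<Sum>y\<in>s ` {a..b}. indicator (?A y) x *\<^sub>R y) = s x"
      using fin by (subst sum.remove[of _ "s x"]) (auto intro!: sum.neutral simp: indicator_def)
  qed
  then show ?thesis by (simp add: simple_bochner_integral_def)
qed

text \<open>The Henstock-Kurzweil integral makes sense in any Banach space, so it can replace
the Bochner integral in all later computations. Both integrals agree on simple functions, and
\<open>h\<close> is already known to be integrable, so the \<open>L\<^sup>1\<close> distance between \<open>h\<close> and its simple approximations
controls the distance between the integrals.\<close>

lemma has_bochner_integral_gen_has_integral:
  fixes h :: "real \<Rightarrow> 'a::banach"
  assumes reg: "regulated_on a b h" and boch: "has_bochner_integral_gen (lebesgue_on {a..b}) h I"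
  shows "(h has_integral I) {a..b}"
proof -
  let ?M = "lebesgue_on {a..b}"
  from boch obtain s where hm: "h \<in> borel_measurable ?M"
    and si: "\<And>i. Bochner_Integration.simple_bochner_integrable ?M (s i)"
    and lim: "(\<lambda>i. \<integral>\<^sup>+y. norm (h y - s i y) \<partial>?M) \<longlonglongrightarrow> 0"
    and lim': "(\<lambda>i. Bochner_Integration.simple_bochner_integral ?M (s i)) \<longlonglongrightarrow> I"
    unfolding has_bochner_integral_gen_def by auto
  have hint: "h integrable_on {a..b}" by (rule regulated_on_integrable[OF reg])
  \<comment> \<open>The difference of Borel functions into a non-separable space need not be Borel, but here
    one of the two takes only finitely many values.\<close>
  have meas: "(\<lambda>x. norm (h x - s i x)) \<in> borel_measurable ?M" for i
  proof -
    have sf: "simple_function ?M (s i)" using si by (auto elim: simple_bochner_integrable.cases)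
    then have fin: "finite (s i ` {a..b})" by (auto simp: simple_function_def)
    have "(\<lambda>x. \<Sum>y\<in>s i ` {a..b}. indicator {x \<in> {a..b}. s i x = y} x * norm (h x - y)) \<in> borel_measurable ?M"
    proof (intro borel_measurable_sum borel_measurable_times)
      fix y
      have "{x \<in> {a..b}. s i x = y} \<in> sets ?M"
        using simple_functionD(2)[OF sf, of "{y}"] by (simp add: vimage_def Int_def conj_commute)
      then show "(indicator {x \<in> {a..b}. s i x = y} :: real \<Rightarrow> real) \<in> borel_measurable ?M"
        by (intro borel_measurable_indicator)
      show "(\<lambda>x. norm (h x - y)) \<in> borel_measurable ?M"
        by (rule measurable_compose[OF hm, where g = "\<lambda>v. norm (v - y)"])
          (intro borel_measurable_continuous_onI continuous_intros)
    qed
    then show ?thesis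
    proof (rule measurable_cong[THEN iffD1, rotated])
      fix x assume "x \<in> space ?M"
      then show "(\<Sum>y\<in>s i ` {a..b}. indicator {x \<in> {a..b}. s i x = y} x * norm (h x - y)) = norm (h x - s i x)"
        using fin by (subst sum.remove[of _ "s i x"]) (auto intro!: sum.neutral simp: indicator_def)
    qed
  qed
  have bound: "ennreal (norm (integral {a..b} h - Bochner_Integration.simple_bochner_integral ?M (s i)))
      \<le> (\<integral>\<^sup>+y. norm (h y - s i y) \<partial>?M)" for i
  proof (cases "(\<integral>\<^sup>+y. norm (h y - s i y) \<partial>?M) = \<infinity>")
    case False
    let ?\<phi> = "\<lambda>x. norm (h x - s i x)"
    have int: "integrable ?M ?\<phi>"
    proof (rule integrableI_bounded[OF meas])
      show "(\<integral>\<^sup>+x. ennreal (norm (norm (h x - s i x))) \<partial>?M) < \<infinity>"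
        using False by (simp add: top.not_eq_extremum)
    qed
    then have "(?\<phi> has_integral integral\<^sup>L ?M ?\<phi>) {a..b}"
      by (rule has_integral_integral_lebesgue_on) simp
    then have \<phi>: "?\<phi> integrable_on {a..b}" "integral {a..b} ?\<phi> = integral\<^sup>L ?M ?\<phi>"
      by (auto simp: has_integral_iff)
    have HI: "((\<lambda>x. h x - s i x) has_integral
        (integral {a..b} h - Bochner_Integration.simple_bochner_integral ?M (s i))) {a..b}"
      by (intro has_integral_diff integrable_integral hint simple_bochner_integral_has_integral si)
    have "norm (integral {a..b} (\<lambda>x. h x - s i x)) \<le> integral {a..b} ?\<phi>"
      by (rule integral_norm_bound_integral[OF has_integral_integrable[OF HI] \<phi>(1)]) simp
    then have "norm (integral {a..b} h - Bochner_Integration.simple_bochner_integral ?M (s i)) \<le> integral\<^sup>L ?M ?\<phi>"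
      unfolding integral_unique[OF HI] \<phi>(2) .
    then have "ennreal (norm (integral {a..b} h - Bochner_Integration.simple_bochner_integral ?M (s i)))
        \<le> ennreal (integral\<^sup>L ?M ?\<phi>)" by (rule ennreal_leI)
    also have "\<dots> = (\<integral>\<^sup>+y. norm (h y - s i y) \<partial>?M)"
      using int by (subst nn_integral_eq_integral) auto
    finally show ?thesis .
  qed simp
  have "(\<lambda>i. ennreal (norm (integral {a..b} h - Bochner_Integration.simple_bochner_integral ?M (s i)))) \<longlonglongrightarrow> 0"
    by (rule tendsto_sandwich[OF _ _ tendsto_const lim]) (auto intro!: always_eventually bound)
  then have "(\<lambda>i. norm (integral {a..b} h - Bochner_Integration.simple_bochner_integral ?M (s i))) \<longlonglongrightarrow> 0"
    by (simp add: ennreal_tendsto_0_iff)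
  then have "(\<lambda>i. integral {a..b} h - Bochner_Integration.simple_bochner_integral ?M (s i)) \<longlonglongrightarrow> 0"
    by (rule tendsto_norm_zero_cancel)
  moreover have "(\<lambda>i. integral {a..b} h - Bochner_Integration.simple_bochner_integral ?M (s i))
      \<longlonglongrightarrow> integral {a..b} h - I"
    by (intro tendsto_intros lim')
  ultimately have "integral {a..b} h - I = 0" by (rule LIMSEQ_unique[rotated])
  then show ?thesis using hint by (simp add: has_integral_iff)
qed

section \<open>Strongly continuous semigroups\<close>

text \<open>The Banach-Steinhaus theorem for a sequence of operators, by Baire category: one of the closed sets of
points at which the sequence is bounded by \<open>k\<close> contains a ball, and differences of points of this ball
fill a neighbourhood of \<open>0\<close>.\<close>

lemma uniform_boundedness:
  fixes F :: "nat \<Rightarrow> 'a::banach \<Rightarrow>\<^sub>L 'b::real_normed_vector"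
  assumes pointwise: "\<And>x. \<exists>B. \<forall>n. norm (F n x) \<le> B"
  shows "\<exists>B. \<forall>n. norm (F n) \<le> B"
proof -
  define A where "A k = {x. \<forall>n. norm (F n x) \<le> real k}" for k :: nat
  have closed: "closed (A k)" for k
  proof -
    have "A k = (\<Inter>n. {x. norm (F n x) \<le> real k})" by (auto simp: A_def)
    then show ?thesis by (auto intro!: closed_INT closed_Collect_le continuous_intros)
  qed
  have cover: "(\<Union>k. A k) = UNIV"
  proof -
    have "\<exists>k. x \<in> A k" for x
    proof -
      obtain B where B: "\<And>n. norm (F n x) \<le> B" using pointwise[of x] by blast
      obtain k where "B \<le> real k" using real_arch_simple by blast
      then have "x \<in> A k" using order_trans[OF B] by (auto simp: A_def)
      then show ?thesis ..
    qed
    then show ?thesis by auto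
  qed
  have "\<exists>k. interior (A k) \<noteq> {}"
  proof (rule ccontr)
    assume "\<not> ?thesis"
    then have "Met_TC.mtopology interior_of \<Union>(range A) = {}"
      using closed by (intro Met_TC.metric_Baire_category_alt)
        auto
    then show False using cover by simp
  qed
  then obtain k a r where r: "0 < r" "cball a r \<subseteq> A k"
    by (metis all_not_in_conv interior_subset mem_interior_cball)
  have "norm (F n) \<le> 2 * real k / r" for n
  proof (rule norm_blinfun_bound)
    show "0 \<le> 2 * real k / r" using r by simp
    fix x
    show "norm (F n x) \<le> 2 * real k / r * norm x"
    proof (cases "x = 0")
      case False
      define y where "y = (r / norm x) *\<^sub>R x"
      have "norm y = r" using False r by (simp add: y_def)
      then have "a + y \<in> A k" "a \<in> A k" using r by (auto simp: subset_iff dist_norm)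
      then have "norm (F n (a + y)) \<le> real k" "norm (F n a) \<le> real k" by (simp_all add: A_def)
      then have "norm (F n (a + y)) + norm (F n a) \<le> 2 * real k" by simp
      moreover have "F n y = F n (a + y) - F n a" by (simp add: blinfun.add_right)
      ultimately have "norm (F n y) \<le> 2 * real k"
        using norm_triangle_ineq4[of "F n (a + y)" "F n a"] by simp
      moreover have "norm (F n y) = r / norm x * norm (F n x)"
        using r by (simp add: y_def blinfun.scaleR_right)
      ultimately show ?thesis using r False by (simp add: field_simps)
    qed simp
  qed
  then show ?thesis by blast
qed

lemma C0_semigroup_near_id:
  assumes "C0_semigroup T" "0 < \<epsilon>"
  obtains d where "0 < d" "\<And>h. \<lbrakk>0 \<le> h; h < d\<rbrakk> \<Longrightarrow> norm (T h x - x) < \<epsilon>"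
proof -
  have "((\<lambda>t. T t x) \<longlongrightarrow> x) (at_right 0)" "T 0 = id_blinfun"
    using assms(1) by (auto simp: C0_semigroup_def)
  then obtain d where "0 < d" "\<And>h. \<lbrakk>0 < h; h < d\<rbrakk> \<Longrightarrow> norm (T h x - x) < \<epsilon>"
    using assms(2) tendstoD[of "\<lambda>t. T t x" x "at_right 0" \<epsilon>]
    by (auto simp: eventually_at_right_field dist_norm)
  then show ?thesis
    using \<open>T 0 = id_blinfun\<close> assms(2) by (intro that[of d]) (auto simp: le_less)
qed

lemma C0_semigroup_add:
  assumes "C0_semigroup T" "0 \<le> s" "0 \<le> t"
  shows "T (s + t) x = T s (T t x)"
  using assms by (simp add: C0_semigroup_def)

text \<open>Otherwise the operator norms would be unbounded along some sequence of times tending to \<open>0\<close>, although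
strong continuity makes that sequence pointwise convergent.\<close>

lemma C0_semigroup_bounded_near_0:
  fixes T :: "real \<Rightarrow> 'x::banach \<Rightarrow>\<^sub>L 'x"
  assumes "C0_semigroup T"
  obtains d M where "0 < d" "\<And>s. \<lbrakk>0 \<le> s; s \<le> d\<rbrakk> \<Longrightarrow> norm (T s) \<le> M"
proof -
  have "\<exists>n. \<forall>s. 0 \<le> s \<and> s \<le> inverse (real (Suc n)) \<longrightarrow> norm (T s) \<le> real n"
  proof (rule ccontr)
    assume "\<not> ?thesis"
    then obtain s where s: "\<And>n. 0 \<le> s n" "\<And>n. s n \<le> inverse (real (Suc n))" "\<And>n. \<not> norm (T (s n)) \<le> real n"
      by metis
    have "\<exists>B. \<forall>n. norm (T (s n) x) \<le> B" for x
    proof -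
      obtain d where d: "0 < d" "\<And>h. \<lbrakk>0 \<le> h; h < d\<rbrakk> \<Longrightarrow> norm (T h x - x) < 1"
        by (rule C0_semigroup_near_id[OF assms, of 1]) auto
      have "s \<longlonglongrightarrow> 0"
        by (rule tendsto_sandwich[OF _ _ tendsto_const LIMSEQ_inverse_real_of_nat])
          (auto intro!: always_eventually s(1,2) simp del: of_nat_Suc)
      then have "(\<lambda>n. T (s n) x) \<longlonglongrightarrow> x"
      proof -
        show ?thesis
        proof (rule tendstoI)
          fix e :: real assume "0 < e"
          then obtain d where "0 < d" "\<And>h. \<lbrakk>0 \<le> h; h < d\<rbrakk> \<Longrightarrow> norm (T h x - x) < e"
            by (rule C0_semigroup_near_id[OF assms]) auto
          with order_tendstoD(2)[OF \<open>s \<longlonglongrightarrow> 0\<close>, of d]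
          show "\<forall>\<^sub>F n in sequentially. dist (T (s n) x) x < e"
            by (auto elim!: eventually_mono simp: dist_norm s(1))
        qed
      qed
      then have "Bseq (\<lambda>n. T (s n) x)" by (intro convergent_imp_Bseq convergentI)
      then show ?thesis by (auto simp: Bseq_def)
    qed
    then obtain B where "\<And>n. norm (T (s n)) \<le> B"
      using uniform_boundedness[of "\<lambda>n. T (s n)"] by blast
    moreover obtain n :: nat where "B \<le> real n" using real_arch_simple by blast
    ultimately show False using s(3)[of n] order_trans by blast
  qed
  then obtain n where "\<And>s. 0 \<le> s \<Longrightarrow> s \<le> inverse (real (Suc n)) \<Longrightarrow> norm (T s) \<le> real n" by blast
  then show ?thesis by (intro that[of "inverse (real (Suc n))" "real n"]) auto
qed

lemma C0_semigroup_locally_bounded: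
  fixes T :: "real \<Rightarrow> 'x::banach \<Rightarrow>\<^sub>L 'x"
  assumes T: "C0_semigroup T"
  obtains M where "0 < M" "\<And>s. \<lbrakk>0 \<le> s; s \<le> \<tau>\<rbrakk> \<Longrightarrow> norm (T s) \<le> M"
proof -
  obtain d M0 where d: "0 < d" and M0: "\<And>s. \<lbrakk>0 \<le> s; s \<le> d\<rbrakk> \<Longrightarrow> norm (T s) \<le> M0"
    using C0_semigroup_bounded_near_0[OF T] by blast
  \<comment> \<open>With \<open>M \<ge> 1\<close> the powers of \<open>M\<close> increase, so the bound at step \<open>n\<close> covers all earlier times.\<close>
  define M where "M = max 1 M0"
  have M: "1 \<le> M" "\<And>s. \<lbrakk>0 \<le> s; s \<le> d\<rbrakk> \<Longrightarrow> norm (T s) \<le> M"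
    using M0 by (auto simp: M_def le_max_iff_disj)
  have pow: "norm (T s) \<le> M ^ Suc n" if "0 \<le> s" "s \<le> real (Suc n) * d" for n s
    using that
  proof (induction n arbitrary: s)
    case (Suc n)
    show ?case
    proof (cases "s \<le> d")
      case True
      have "M ^ 1 \<le> M ^ Suc (Suc n)" using M by (intro power_increasing) auto
      then show ?thesis using M(2)[of s] Suc.prems True by simp
    next
      case False
      have "T s = T d o\<^sub>L T (s - d)"
        using T d False unfolding C0_semigroup_def
        by (metis add.commute diff_add_cancel diff_ge_0_iff_ge less_imp_le not_le)
      then have "norm (T s) \<le> norm (T d) * norm (T (s - d))" by (simp add: norm_blinfun_compose)
      also have "\<dots> \<le> M * M ^ Suc n"
        using M d False Suc.prems by (intro mult_mono Suc.IH M(2)) (auto simp: algebra_simps)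
      finally show ?thesis by simp
    qed
  qed (use M in auto)
  obtain n :: nat where "\<tau> < real n * d" using d ex_less_of_nat_mult by blast
  then have "\<tau> \<le> real (Suc n) * d" using d by (simp add: algebra_simps)
  then have "norm (T s) \<le> M ^ Suc n" if "0 \<le> s" "s \<le> \<tau>" for s
    using that by (intro pow) auto
  then show ?thesis using M(1) by (intro that[of "M ^ Suc n"]) auto
qed

text \<open>Joint continuity of \<open>(t, y) \<mapsto> T t y\<close>, phrased for filters so that it applies to one-sided limits.\<close>

lemma C0_semigroup_tendsto:
  fixes T :: "real \<Rightarrow> 'x::banach \<Rightarrow>\<^sub>L 'x"
  assumes T: "C0_semigroup T" and p: "(p \<longlongrightarrow> t) F" "\<forall>\<^sub>F s in F. 0 \<le> p s" and t: "0 \<le> t"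
    and g: "(g \<longlongrightarrow> y) F"
  shows "((\<lambda>s. T (p s) (g s)) \<longlongrightarrow> T t y) F"
proof (rule tendstoI)
  fix e :: real assume e: "0 < e"
  obtain M where M: "0 < M" "\<And>s. \<lbrakk>0 \<le> s; s \<le> t + 1\<rbrakk> \<Longrightarrow> norm (T s) \<le> M"
    using C0_semigroup_locally_bounded[OF T] by blast
  obtain d where d: "0 < d" "\<And>h. \<lbrakk>0 \<le> h; h < d\<rbrakk> \<Longrightarrow> norm (T h y - y) < e / (2 * M)"
    by (rule C0_semigroup_near_id[OF T, of "e / (2 * M)"]) (use e M in auto)
  have bd: "norm (T s z) \<le> M * norm z" if "0 \<le> s" "s \<le> t + 1" for s z
    using norm_blinfun[of "T s" z] M(2)[OF that] by (meson mult_right_mono norm_ge_zero order_trans)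
  have cont: "norm (T s y - T t y) \<le> e / 2" if "0 \<le> s" "s \<le> t + 1" "\<bar>s - t\<bar> < d" for s
  proof -
    have *: "norm (T (a + h) y - T a y) \<le> e / 2" if "0 \<le> a" "a \<le> t + 1" "0 \<le> h" "h < d" for a h
    proof -
      have "T (a + h) y - T a y = T a (T h y - y)"
        using that C0_semigroup_add[OF T] by (simp add: blinfun.diff_right)
      then have "norm (T (a + h) y - T a y) \<le> M * norm (T h y - y)" using bd that by simp
      also have "\<dots> \<le> M * (e / (2 * M))" using d(2)[of h] M(1) that by (intro mult_left_mono) auto
      finally show ?thesis using M(1) by simp
    qed
    show ?thesis
    proof (cases "s \<le> t")
      case True
      then show ?thesis using *[of s "t - s"] that by (simp add: norm_minus_commute)
    next
      case False
      then show ?thesis using *[of t "s - t"] that t by simp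
    qed
  qed
  have "\<forall>\<^sub>F s in F. \<bar>p s - t\<bar> < min 1 d"
    using tendstoD[OF p(1), of "min 1 d"] d(1) by (simp add: dist_real_def)
  moreover have "\<forall>\<^sub>F s in F. norm (g s - y) < e / (2 * M)"
    using tendstoD[OF g, of "e / (2 * M)"] e M(1) by (simp add: dist_norm)
  ultimately show "\<forall>\<^sub>F s in F. dist (T (p s) (g s)) (T t y) < e"
    using p(2)
  proof eventually_elim
    case (elim s)
    have "T (p s) (g s) - T t y = T (p s) (g s - y) + (T (p s) y - T t y)"
      by (simp add: blinfun.diff_right)
    then have "dist (T (p s) (g s)) (T t y) \<le> norm (T (p s) (g s - y)) + norm (T (p s) y - T t y)"
      by (metis dist_norm norm_triangle_ineq)
    moreover have "norm (T (p s) (g s - y)) \<le> M * norm (g s - y)" using elim by (intro bd) auto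
    moreover have "M * norm (g s - y) < e / 2" using elim(2) M(1) by (simp add: field_simps)
    moreover have "norm (T (p s) y - T t y) \<le> e / 2" using elim by (intro cont) auto
    ultimately show ?case by simp
  qed
qed

lemma regulated_on_semigroup:
  fixes T :: "real \<Rightarrow> 'x::banach \<Rightarrow>\<^sub>L 'x"
  assumes T: "C0_semigroup T" and h: "regulated_on a t h"
  shows "regulated_on a t (\<lambda>s. T (t - s) (h s))"
  unfolding regulated_on_def
proof (intro conjI ballI)
  fix s assume s: "s \<in> {a..<t}"
  then obtain l where l: "(h \<longlongrightarrow> l) (at_right s)" using h by (force simp: regulated_on_def)
  have "\<forall>\<^sub>F r in at_right s. 0 \<le> t - r"
    unfolding eventually_at_right_field using s by (intro exI[of _ t]) auto
  then have "((\<lambda>r. T (t - r) (h r)) \<longlongrightarrow> T (t - s) l) (at_right s)"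
    using s by (intro C0_semigroup_tendsto T l tendsto_intros) auto
  then show "\<exists>l. ((\<lambda>r. T (t - r) (h r)) \<longlongrightarrow> l) (at_right s)" ..
next
  fix s assume s: "s \<in> {a<..t}"
  then obtain l where l: "(h \<longlongrightarrow> l) (at_left s)" using h by (force simp: regulated_on_def)
  have "\<forall>\<^sub>F r in at_left s. 0 \<le> t - r"
    unfolding eventually_at_left_field using s by (intro exI[of _ "s - 1"]) auto
  then have "((\<lambda>r. T (t - r) (h r)) \<longlongrightarrow> T (t - s) l) (at_left s)"
    using s by (intro C0_semigroup_tendsto T l tendsto_intros) auto
  then show "\<exists>l. ((\<lambda>r. T (t - r) (h r)) \<longlongrightarrow> l) (at_left s)" ..
qed

section \<open>Gronwall's inequality\<close>

text \<open>The function \<open>\<psi> s = (A + K \<integral>g) exp (- K (s - a))\<close> is nonincreasing, because its derivative has the sign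
of \<open>g s - (A + K \<integral>g) \<le> 0\<close>.\<close>

lemma gronwall:
  fixes g :: "real \<Rightarrow> real"
  assumes cont: "continuous_on {a..b} g" and K: "0 \<le> K"
    and le: "\<And>t. t \<in> {a..b} \<Longrightarrow> g t \<le> A + K * integral {a..t} g" and t: "t \<in> {a..b}"
  shows "g t \<le> A * exp (K * (t - a))"
proof -
  define \<psi> where "\<psi> s = (A + K * integral {a..s} g) * exp (- K * (s - a))" for s
  have G: "continuous_on {a..t} (\<lambda>s. integral {a..s} g)"
    using t by (intro indefinite_integral_continuous_1 integrable_continuous_real continuous_on_subset[OF cont]) auto
  have "\<psi> t \<le> \<psi> a"
  proof (cases "a = t")
    case False
    show ?thesis
    proof (rule DERIV_nonpos_imp_decreasing_open[where f = \<psi> and a = a and b = t])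
      show "a \<le> t" using t by simp
      show "continuous_on {a..t} \<psi>" unfolding \<psi>_def by (intro continuous_intros G)
      fix s assume s: "a < s" "s < t"
      have "((\<lambda>s. integral {a..s} g) has_real_derivative g s) (at s within {a..b})"
        using s t by (intro integral_has_real_derivative cont) auto
      then have "((\<lambda>s. integral {a..s} g) has_real_derivative g s) (at s)"
        using s t by (simp add: at_within_Icc_at)
      then have "(\<psi> has_real_derivative
          (K * g s) * exp (- K * (s - a)) + (A + K * integral {a..s} g) * (exp (- K * (s - a)) * (- K))) (at s)"
        unfolding \<psi>_def by (auto intro!: derivative_eq_intros)
      moreover have "(K * g s) * exp (- K * (s - a)) + (A + K * integral {a..s} g) * (exp (- K * (s - a)) * (- K))
          = K * exp (- K * (s - a)) * (g s - (A + K * integral {a..s} g))" by (simp add: algebra_simps)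
      moreover have "\<dots> \<le> 0" using le[of s] s t K by (intro mult_nonneg_nonpos) auto
      ultimately show "\<exists>y. DERIV \<psi> s :> y \<and> y \<le> 0" by metis
    qed
  qed simp
  then have "(A + K * integral {a..t} g) * exp (- K * (t - a)) * exp (K * (t - a)) \<le> A * exp (K * (t - a))"
    by (intro mult_right_mono) (auto simp: \<psi>_def)
  moreover have "exp (- K * (t - a)) * exp (K * (t - a)) = 1" by (simp flip: exp_add)
  ultimately have "A + K * integral {a..t} g \<le> A * exp (K * (t - a))"
    by (simp only: mult.assoc mult_1_right)
  then show ?thesis using le[OF t] by simp
qed

section \<open>Mild solutions\<close>

text \<open>The integral is taken in the sense of Henstock and Kurzweil, which commutes with bounded operators and is
additive over adjacent intervals in every Banach space; under (SL1) weak solutions for admissible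
inputs satisfy the equation in this sense.\<close>

definition mild_solution ::
  "(real \<Rightarrow> 'x::banach \<Rightarrow>\<^sub>L 'x) \<Rightarrow> (real \<Rightarrow> 'x \<Rightarrow> 'u \<Rightarrow> 'x) \<Rightarrow>
   real \<Rightarrow> 'x \<Rightarrow> (real \<Rightarrow> 'u) \<Rightarrow> real \<Rightarrow> (real \<Rightarrow> 'x) \<Rightarrow> bool" where
  "mild_solution T f t0 x0 u b x \<longleftrightarrow> continuous_on {t0..b} x \<and>
     (\<forall>t\<in>{t0..b}. ((\<lambda>s. T (t - s) (f s (x s) (u s))) has_integral (x t - T (t - t0) x0)) {t0..t})"

lemma mild_solution_initial:
  assumes "C0_semigroup T" "mild_solution T f t0 x0 u b x" "t0 \<le> b"
  shows "x t0 = x0"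
proof -
  have "((\<lambda>s. T (t0 - s) (f s (x s) (u s))) has_integral (x t0 - T (t0 - t0) x0)) {t0..t0}"
    using assms(2,3) unfolding mild_solution_def by (metis atLeastAtMost_iff order_refl)
  moreover have "((\<lambda>s. T (t0 - s) (f s (x s) (u s))) has_integral 0) {t0..t0}"
    unfolding cbox_interval[symmetric] by (rule has_integral_refl)
  ultimately have "x t0 - T (t0 - t0) x0 = 0" by (rule has_integral_unique)
  then show ?thesis using assms(1) by (simp add: C0_semigroup_def)
qed

text \<open>Apply \<open>T (t - r)\<close> to the equation at time \<open>r\<close> and subtract the result from the equation at time \<open>t\<close>.\<close>

lemma mild_solution_restart:
  assumes T: "C0_semigroup T" and x: "mild_solution T f t0 x0 u b x" and r: "t0 \<le> r"
  shows "mild_solution T f r (x r) u b x"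
  unfolding mild_solution_def
proof (intro conjI ballI)
  show "continuous_on {r..b} x"
    using x r by (auto simp: mild_solution_def intro: continuous_on_subset)
  fix t assume t: "t \<in> {r..b}"
  let ?h = "\<lambda>t s. T (t - s) (f s (x s) (u s))"
  have ht: "(?h t has_integral (x t - T (t - t0) x0)) {t0..t}"
    and hr: "(?h r has_integral (x r - T (r - t0) x0)) {t0..r}"
    using x r t by (auto simp: mild_solution_def)
  have T_add: "T (t - r) (T (r - s) y) = T (t - s) y" if "s \<le> r" for s y
    using C0_semigroup_add[OF T, of "t - r" "r - s" y] t that by simp
  have "((\<lambda>s. T (t - r) (?h r s)) has_integral T (t - r) (x r - T (r - t0) x0)) {t0..r}"
    using has_integral_linear[OF hr blinfun.bounded_linear_right[of "T (t - r)"]] by (simp add: o_def)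
  then have "((\<lambda>s. T (t - r) (?h r s)) has_integral (T (t - r) (x r) - T (t - t0) x0)) {t0..r}"
    using r by (simp add: blinfun.diff_right T_add)
  then have "(?h t has_integral (T (t - r) (x r) - T (t - t0) x0)) {t0..r}"
    by (rule has_integral_eq[rotated]) (simp add: T_add)
  moreover have "?h t integrable_on {r..t}"
    by (rule integrable_subinterval_real[OF has_integral_integrable[OF ht]]) (use r in auto)
  then obtain J where J: "(?h t has_integral J) {r..t}" by blast
  ultimately have "(?h t has_integral ((T (t - r) (x r) - T (t - t0) x0) + J)) {t0..t}"
    using r t by (intro has_integral_combine[of t0 r t]) auto
  with ht have "x t - T (t - t0) x0 = (T (t - r) (x r) - T (t - t0) x0) + J"
    by (rule has_integral_unique)
  then have "J = x t - T (t - r) (x r)" by (simp add: algebra_simps)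
  with J show "(?h t has_integral (x t - T (t - r) (x r))) {r..t}" by simp
qed

text \<open>The one Gronwall estimate from which both uniqueness (\<open>w = 0\<close>) and the comparison of forced and unforced
trajectories follow; \<open>w\<close> collects the effect of the inputs.\<close>

lemma mild_solution_difference:
  fixes T :: "real \<Rightarrow> 'x::banach \<Rightarrow>\<^sub>L 'x"
  assumes x: "mild_solution T f t0 x0 u b x" and z: "mild_solution T f t0 x0 v b z"
    and M: "0 \<le> M" "\<And>r. \<lbrakk>0 \<le> r; r \<le> b - t0\<rbrakk> \<Longrightarrow> norm (T r) \<le> M"
    and L: "0 \<le> L" and w: "w integrable_on {t0..b}" "\<And>s. s \<in> {t0..b} \<Longrightarrow> 0 \<le> w s"
    and le: "\<And>s. s \<in> {t0..b} \<Longrightarrow>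
      norm (f s (x s) (u s) - f s (z s) (v s)) \<le> w s + L * norm (x s - z s)"
    and t: "t \<in> {t0..b}"
  shows "norm (x t - z t) \<le> M * integral {t0..b} w * exp (M * L * (t - t0))"
proof (rule gronwall[where b = b and g = "\<lambda>s. norm (x s - z s)"])
  show cont: "continuous_on {t0..b} (\<lambda>s. norm (x s - z s))"
    using x z by (auto simp: mild_solution_def intro!: continuous_intros)
  fix t assume t: "t \<in> {t0..b}"
  let ?d = "\<lambda>s. T (t - s) (f s (x s) (u s)) - T (t - s) (f s (z s) (v s))"
  have sub: "{t0..t} \<subseteq> {t0..b}" using t by auto
  have d: "(?d has_integral (x t - z t)) {t0..t}"
    using has_integral_diff[of _ "x t - T (t - t0) x0" "{t0..t}" _ "z t - T (t - t0) x0"] x z t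
    by (simp add: mild_solution_def)
  have int: "(\<lambda>s. norm (x s - z s)) integrable_on {t0..t}"
    by (intro integrable_continuous_real continuous_on_subset[OF cont] sub)
  have wint: "w integrable_on {t0..t}" by (rule integrable_subinterval_real[OF w(1) sub])
  have "norm (integral {t0..t} ?d) \<le> integral {t0..t} (\<lambda>s. M * (w s + L * norm (x s - z s)))"
  proof (rule integral_norm_bound_integral)
    show "?d integrable_on {t0..t}" using d by blast
    show "(\<lambda>s. M * (w s + L * norm (x s - z s))) integrable_on {t0..t}"
      by (intro integrable_on_mult_right integrable_add wint int)
    fix s assume s: "s \<in> {t0..t}"
    have "norm (?d s) = norm (T (t - s) (f s (x s) (u s) - f s (z s) (v s)))"
      by (simp add: blinfun.diff_right)
    also have "\<dots> \<le> norm (T (t - s)) * norm (f s (x s) (u s) - f s (z s) (v s))"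
      by (rule norm_blinfun)
    also have "\<dots> \<le> M * (w s + L * norm (x s - z s))"
      using s t M le[of s] by (intro mult_mono) auto
    finally show "norm (?d s) \<le> M * (w s + L * norm (x s - z s))" .
  qed
  also have "integral {t0..t} ?d = x t - z t" using d by (rule integral_unique)
  also have "integral {t0..t} (\<lambda>s. M * (w s + L * norm (x s - z s)))
      = M * integral {t0..t} w + M * L * integral {t0..t} (\<lambda>s. norm (x s - z s))"
    using wint int by (simp add: integral_add integrable_on_mult_right algebra_simps)
  also have "M * integral {t0..t} w \<le> M * integral {t0..b} w"
    using w(2) by (intro mult_left_mono integral_subset_le sub wint w(1) M(1)) auto
  finally show "norm (x t - z t) \<le> M * integral {t0..b} w + M * L * integral {t0..t} (\<lambda>s. norm (x s - z s))"
    by simp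
qed (use M L t in auto)

text \<open>At a break point \<open>\<tau> k\<close> the one-sided limits of the forcing are computed with the continuous extensions \<open>F\<close>
of two neighbouring pieces. Hence the index is selected by \<open>\<tau> k \<le> s < \<tau> (k + 1)\<close> for limits from the right
and by \<open>\<tau> k < s \<le> \<tau> (k + 1)\<close> for limits from the left.\<close>

lemma SL1_regulated:
  fixes f :: "real \<Rightarrow> 'x::real_normed_vector \<Rightarrow> 'u::real_normed_vector \<Rightarrow> 'x"
  assumes f: "SL1 f" and a: "0 \<le> a" and x: "continuous_on {a..b} x" and u: "regulated_on a b u"
  shows "regulated_on a b (\<lambda>s. f s (x s) (u s))"
proof -
  obtain \<tau> F where H: "\<tau> 0 = (0::real) \<and> strict_mono \<tau> \<and> \<not> bdd_above (range \<tau>) \<and>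
     (\<forall>k. continuous_on ({\<tau> k..\<tau> (Suc k)} \<times> UNIV \<times> UNIV) (\<lambda>(t, \<xi>, \<mu>). F k t \<xi> \<mu>)) \<and>
     (\<forall>k. \<forall>t\<in>{\<tau> k..<\<tau> (Suc k)}. \<forall>\<xi> \<mu>. f t \<xi> \<mu> = F k t \<xi> \<mu>)"
    using f unfolding SL1_def by (elim exE) (rule that)
  have \<tau>: "\<tau> 0 = 0" "strict_mono \<tau>" "\<not> bdd_above (range \<tau>)"
    using H by blast+
  have F: "continuous_on ({\<tau> k..\<tau> (Suc k)} \<times> UNIV \<times> UNIV) (\<lambda>(t, \<xi>, \<mu>). F k t \<xi> \<mu>)" for k
    using H by (elim conjE) (erule spec)
  have fF: "f t \<xi> \<mu> = F k t \<xi> \<mu>" if "t \<in> {\<tau> k..<\<tau> (Suc k)}" for k t \<xi> \<mu>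
    using H[THEN conjunct2, THEN conjunct2, THEN conjunct2, THEN conjunct2, THEN spec, THEN bspec, OF that]
    by blast
  have ex: "\<exists>n. s < \<tau> n" for s
    using \<tau>(3) by (auto simp: bdd_above_def not_le)
  have lim: "((\<lambda>r. f r (x r) (u r)) \<longlongrightarrow> F k s (x s) l) G"
    if G: "(x \<longlongrightarrow> x s) G" "(u \<longlongrightarrow> l) G" "((\<lambda>r. r) \<longlongrightarrow> s) G"
      and ev: "\<forall>\<^sub>F r in G. r \<in> {\<tau> k..<\<tau> (Suc k)}" and s: "s \<in> {\<tau> k..\<tau> (Suc k)}" for G s k l
  proof -
    have "((\<lambda>r. (r, x r, u r)) \<longlongrightarrow> (s, x s, l)) G" by (intro tendsto_intros G)
    from continuous_on_tendsto_compose[OF F[of k] this]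
    have "((\<lambda>r. F k r (x r) (u r)) \<longlongrightarrow> F k s (x s) l) G"
      using s eventually_mono[OF ev] by simp
    then show ?thesis
      by (rule Lim_transform_eventually) (rule eventually_mono[OF ev], simp add: fF)
  qed
  show ?thesis
    unfolding regulated_on_def
  proof (intro conjI ballI)
    fix s assume s: "s \<in> {a..<b}"
    define n where "n = (LEAST n. s < \<tau> n)"
    have n: "s < \<tau> n" unfolding n_def by (rule LeastI_ex[OF ex])
    then obtain k where k: "n = Suc k" using s a \<tau>(1) by (cases n) auto
    have k': "\<tau> k \<le> s" using not_less_Least[of k "\<lambda>n. s < \<tau> n"] k n_def by simp
    obtain l where l: "(u \<longlongrightarrow> l) (at_right s)"
      using u s unfolding regulated_on_def by blast
    have "(x \<longlongrightarrow> x s) (at s within {a..b})" using x s by (auto simp: continuous_on_def)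
    then have "(x \<longlongrightarrow> x s) (at s within {s..b})" by (rule tendsto_within_subset) (use s in auto)
    then have "(x \<longlongrightarrow> x s) (at_right s)" using s by (simp add: at_within_Icc_at_right)
    moreover have "\<forall>\<^sub>F r in at_right s. r \<in> {\<tau> k..<\<tau> (Suc k)}"
      unfolding eventually_at_right_field using n k k' by (intro exI[of _ "\<tau> n"]) auto
    ultimately have "((\<lambda>r. f r (x r) (u r)) \<longlongrightarrow> F k s (x s) l) (at_right s)"
      using n k k' by (intro lim l tendsto_ident_at) auto
    then show "\<exists>l. ((\<lambda>r. f r (x r) (u r)) \<longlongrightarrow> l) (at_right s)" ..
  next
    fix s assume s: "s \<in> {a<..b}"
    define n where "n = (LEAST n. s \<le> \<tau> n)"
    have n: "s \<le> \<tau> n" unfolding n_def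
      by (rule LeastI_ex[where P = "\<lambda>n. s \<le> \<tau> n"]) (use ex[of s] less_imp_le in blast)
    then obtain k where k: "n = Suc k" using s a \<tau>(1) by (cases n) auto
    have k': "\<tau> k < s" using not_less_Least[of k "\<lambda>n. s \<le> \<tau> n"] k n_def by simp
    obtain l where l: "(u \<longlongrightarrow> l) (at_left s)"
      using u s unfolding regulated_on_def by blast
    have "(x \<longlongrightarrow> x s) (at s within {a..b})" using x s by (auto simp: continuous_on_def)
    then have "(x \<longlongrightarrow> x s) (at s within {a..s})" by (rule tendsto_within_subset) (use s in auto)
    then have "(x \<longlongrightarrow> x s) (at_left s)" using s by (simp add: at_within_Icc_at_left)
    moreover have "\<forall>\<^sub>F r in at_left s. r \<in> {\<tau> k..<\<tau> (Suc k)}"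
      unfolding eventually_at_left_field using n k k' by (intro exI[of _ "\<tau> k"]) auto
    ultimately have "((\<lambda>r. f r (x r) (u r)) \<longlongrightarrow> F k s (x s) l) (at_left s)"
      using n k k' by (intro lim l tendsto_ident_at) auto
    then show "\<exists>l. ((\<lambda>r. f r (x r) (u r)) \<longlongrightarrow> l) (at_left s)" ..
  qed
qed

lemma admissible_regulated: "\<lbrakk>admissible_input u; 0 \<le> a\<rbrakk> \<Longrightarrow> regulated_on a b u"
  by (auto simp: admissible_input_def regulated_on_def)

lemma weak_solution_mild:
  fixes T :: "real \<Rightarrow> 'x::banach \<Rightarrow>\<^sub>L 'x"
  assumes T: "C0_semigroup T" and f: "SL1 f" and t0: "0 \<le> t0" and u: "admissible_input u"
    and x: "weak_solution T f t0 x0 u J x" and J: "{t0..b} \<subseteq> J"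
  shows "mild_solution T f t0 x0 u b x"
  unfolding mild_solution_def
proof (intro conjI ballI)
  show cont: "continuous_on {t0..b} x"
    using x J by (auto simp: weak_solution_def intro: continuous_on_subset)
  fix t assume t: "t \<in> {t0..b}"
  then obtain I where I: "has_bochner_integral_gen (lebesgue_on {t0..t})
      (\<lambda>s. T (t - s) (f s (x s) (u s))) I" "x t = T (t - t0) x0 + I"
    using x J unfolding weak_solution_def by blast
  have "continuous_on {t0..t} x"
    using t by (auto intro: continuous_on_subset[OF cont])
  then have "regulated_on t0 t (\<lambda>s. T (t - s) (f s (x s) (u s)))"
    by (rule regulated_on_semigroup[OF T SL1_regulated[OF f t0 _ admissible_regulated[OF u t0]]])
  from has_bochner_integral_gen_has_integral[OF this I(1)]
  show "((\<lambda>s. T (t - s) (f s (x s) (u s))) has_integral (x t - T (t - t0) x0)) {t0..t}"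
    using I(2) by simp
qed

lemma SL2_lipschitz:
  assumes "SL2 f" "0 < r"
  obtains L where "0 \<le> L" "\<And>t \<xi> \<omega> \<mu>. \<lbrakk>0 \<le> t; norm \<xi> \<le> r; norm \<omega> \<le> r; norm \<mu> \<le> r\<rbrakk> \<Longrightarrow>
     norm (f t \<xi> \<mu> - f t \<omega> \<mu>) \<le> L * norm (\<xi> - \<omega>)"
proof -
  obtain L where "0 \<le> L \<and> (\<forall>t\<ge>0. \<forall>\<xi> \<omega> \<mu>. norm \<xi> \<le> r \<and> norm \<omega> \<le> r \<and> norm \<mu> \<le> r \<longrightarrow>
     norm (f t \<xi> \<mu> - f t \<omega> \<mu>) \<le> L * norm (\<xi> - \<omega>))"
    using assms unfolding SL2_def by metis
  then show ?thesis by (intro that[of L]) auto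
qed

lemma mild_solution_unique:
  fixes T :: "real \<Rightarrow> 'x::banach \<Rightarrow>\<^sub>L 'x"
  assumes T: "C0_semigroup T" and f: "SL2 f" and t0: "0 \<le> t0" and u: "admissible_input u"
    and x: "mild_solution T f t0 x0 u b x" and z: "mild_solution T f t0 x0 u b z"
    and t: "t \<in> {t0..b}"
  shows "x t = z t"
proof -
  have bd: "\<exists>B. \<forall>s\<in>{t0..b}. norm (y s) \<le> B" if "mild_solution T f t0 x0 u b y" for y
  proof -
    have "bounded (y ` {t0..b})"
      using that by (intro compact_imp_bounded compact_continuous_image) (auto simp: mild_solution_def)
    then show ?thesis by (auto simp: bounded_iff)
  qed
  obtain B1 B2 where B12: "\<And>s. s \<in> {t0..b} \<Longrightarrow> norm (x s) \<le> B1" "\<And>s. s \<in> {t0..b} \<Longrightarrow> norm (z s) \<le> B2"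
    using bd[OF x] bd[OF z] by blast
  obtain B3 where "\<And>s. s \<in> {t0..b} \<Longrightarrow> norm (u s) \<le> B3"
    using regulated_on_bounded[OF admissible_regulated[OF u t0], of b] t by fastforce
  note B = B12 this
  define r where "r = max 1 (max B1 (max B2 B3))"
  have r: "0 < r" "B1 \<le> r" "B2 \<le> r" "B3 \<le> r" by (auto simp: r_def)
  obtain L where L: "0 \<le> L" "\<And>t \<xi> \<omega> \<mu>. \<lbrakk>0 \<le> t; norm \<xi> \<le> r; norm \<omega> \<le> r; norm \<mu> \<le> r\<rbrakk> \<Longrightarrow>
     norm (f t \<xi> \<mu> - f t \<omega> \<mu>) \<le> L * norm (\<xi> - \<omega>)"
    by (rule SL2_lipschitz[OF f r(1)]) blast
  obtain M where M: "0 < M" "\<And>s. \<lbrakk>0 \<le> s; s \<le> b - t0\<rbrakk> \<Longrightarrow> norm (T s) \<le> M"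
    using C0_semigroup_locally_bounded[OF T] by blast
  have "norm (x t - z t) \<le> M * integral {t0..b} (\<lambda>_. 0) * exp (M * L * (t - t0))"
  proof (rule mild_solution_difference[OF x z _ M(2) L(1) _ _ _ t])
    fix s assume s: "s \<in> {t0..b}"
    have "norm (f s (x s) (u s) - f s (z s) (u s)) \<le> L * norm (x s - z s)"
      using B(1)[OF s] B(2)[OF s] B(3)[OF s] s t0 r by (intro L) auto
    then show "norm (f s (x s) (u s) - f s (z s) (u s)) \<le> 0 + L * norm (x s - z s)" by simp
  qed (use M in auto)
  then show ?thesis by simp
qed

text \<open>The definite description in the flow denotes the value of a global solution, since by
uniqueness every other maximal solution agrees with it wherever both are defined.\<close>

lemma flow_mild_solution:
  fixes T :: "real \<Rightarrow> 'x::banach \<Rightarrow>\<^sub>L 'x"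
  assumes T: "C0_semigroup T" and f: "SL1 f" "SL2 f" and t0: "0 \<le> t0" and u: "admissible_input u"
    and gd: "globally_defined T f t0 x0 u"
  shows "mild_solution T f t0 x0 u b (\<lambda>t. flow T f t t0 x0 u)"
proof -
  obtain x where x: "maximal_weak_solution T f t0 x0 u \<infinity> x"
    using gd by (auto simp: globally_defined_def)
  have mild: "mild_solution T f t0 x0 u c y"
    if "maximal_weak_solution T f t0 x0 u \<tau> y" "c \<in> interval_to t0 \<tau>" for c y \<tau>
  proof (rule weak_solution_mild[OF T f(1) t0 u])
    show "weak_solution T f t0 x0 u (interval_to t0 \<tau>) y"
      using that by (simp add: maximal_weak_solution_def)
    show "{t0..c} \<subseteq> interval_to t0 \<tau>"
      using that by (auto simp: interval_to_def intro: le_less_trans[of _ "ereal c"])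
  qed
  have eq: "flow T f t t0 x0 u = x t" if t: "t0 \<le> t" for t
    unfolding flow_def
  proof (rule the_equality)
    show "\<exists>\<tau> y. maximal_weak_solution T f t0 x0 u \<tau> y \<and> t \<in> interval_to t0 \<tau> \<and> x t = y t"
      using x t by (intro exI[of _ \<infinity>] exI[of _ x]) (auto simp: interval_to_def)
    fix v assume "\<exists>\<tau> y. maximal_weak_solution T f t0 x0 u \<tau> y \<and> t \<in> interval_to t0 \<tau> \<and> v = y t"
    then obtain \<tau> y where y: "maximal_weak_solution T f t0 x0 u \<tau> y" "t \<in> interval_to t0 \<tau>" "v = y t"
      by blast
    have "t \<in> interval_to t0 \<infinity>" using t by (simp add: interval_to_def)
    then have "y t = x t"
      using mild_solution_unique[OF T f(2) t0 u mild[OF y(1,2)] mild[OF x]] t by simp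
    then show "v = x t" using y(3) by simp
  qed
  show ?thesis
  proof (cases "t0 \<le> b")
    case True
    then have x': "mild_solution T f t0 x0 u b x"
      by (intro mild[OF x]) (auto simp: interval_to_def)
    show ?thesis
      unfolding mild_solution_def
    proof (intro conjI ballI)
      have "continuous_on {t0..b} x" using x' by (simp add: mild_solution_def)
      then show "continuous_on {t0..b} (\<lambda>t. flow T f t t0 x0 u)"
        by (rule continuous_on_eq) (simp add: eq)
      fix t assume t: "t \<in> {t0..b}"
      then have "((\<lambda>s. T (t - s) (f s (x s) (u s))) has_integral (x t - T (t - t0) x0)) {t0..t}"
        using x' by (simp add: mild_solution_def)
      then have "((\<lambda>s. T (t - s) (f s (flow T f s t0 x0 u) (u s))) has_integral
          (x t - T (t - t0) x0)) {t0..t}"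
        by (rule has_integral_eq[rotated]) (simp add: eq)
      then show "((\<lambda>s. T (t - s) (f s (flow T f s t0 x0 u) (u s))) has_integral
          (flow T f t t0 x0 u - T (t - t0) x0)) {t0..t}"
        using eq[of t] t by simp
    qed
  qed (auto simp: mild_solution_def)
qed

lemma flow_initial:
  fixes T :: "real \<Rightarrow> 'x::banach \<Rightarrow>\<^sub>L 'x"
  assumes "C0_semigroup T" "SL1 f" "SL2 f" "0 \<le> t0" "admissible_input u" "globally_defined T f t0 x0 u"
  shows "flow T f t0 t0 x0 u = x0"
  using mild_solution_initial[OF assms(1) flow_mild_solution[OF assms, of t0]] by simp

lemma flow_cocycle:
  fixes T :: "real \<Rightarrow> 'x::banach \<Rightarrow>\<^sub>L 'x"
  assumes T: "C0_semigroup T" and f: "SL1 f" "SL2 f" and t0: "0 \<le> t0" and u: "admissible_input u"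
    and fc: "forward_complete T f" and s: "t0 \<le> s" "s \<le> t"
  shows "flow T f t s (flow T f s t0 x0 u) u = flow T f t t0 x0 u"
proof -
  have gd: "globally_defined T f r y u" if "0 \<le> r" for r y
    using fc u that by (simp add: forward_complete_def)
  have s0: "0 \<le> s" using t0 s by simp
  let ?x = "\<lambda>t. flow T f t t0 x0 u" and ?z = "\<lambda>t. flow T f t s (flow T f s t0 x0 u) u"
  have "mild_solution T f t0 x0 u t ?x"
    by (rule flow_mild_solution[OF T f t0 u gd[OF t0]])
  then have x: "mild_solution T f s (flow T f s t0 x0 u) u t ?x"
    by (rule mild_solution_restart[OF T _ s(1)])
  have z: "mild_solution T f s (flow T f s t0 x0 u) u t ?z"
    by (rule flow_mild_solution[OF T f s0 u gd[OF s0]])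
  have "t \<in> {s..t}" using s by simp
  then show ?thesis by (rule mild_solution_unique[OF T f(2) s0 u z x])
qed

section \<open>Comparison with the unforced flow\<close>

text \<open>Small inputs are absorbed in the error \<open>e\<close> by (SL4). For the others \<open>\<gamma> (norm \<mu>) \<ge> \<gamma> \<delta> > 0\<close>, so the constant
term in the growth bound (SL3) is itself at most a multiple of \<open>\<gamma> (norm \<mu>)\<close>. This is
the reason why \<open>\<gamma>\<close> enters the iISS gain.\<close>

lemma SL3_SL4_input_effect:
  fixes f :: "real \<Rightarrow> 'x::real_normed_vector \<Rightarrow> 'u::real_normed_vector \<Rightarrow> 'x"
  assumes f: "SL3 \<gamma> f" "SL4 f" and R: "0 < R" and e: "0 < e"
  obtains C where "0 \<le> C" "\<And>t \<xi> \<mu>. \<lbrakk>0 \<le> t; norm \<xi> \<le> R\<rbrakk> \<Longrightarrow>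
    norm (f t \<xi> \<mu> - f t \<xi> 0) \<le> e + C * \<gamma> (norm \<mu>)"
proof -
  have K: "class_K \<gamma>" using f(1) by (simp add: SL3_def class_Kinf_def)
  obtain N where N: "mono_on {0..} N" "\<And>r. 0 \<le> r \<Longrightarrow> N r > 0"
    "\<And>t \<xi> \<mu>. 0 \<le> t \<Longrightarrow> norm (f t \<xi> \<mu>) \<le> N (norm \<xi>) * (1 + \<gamma> (norm \<mu>))"
    using f(1) unfolding SL3_def by metis
  obtain \<delta> where \<delta>: "0 < \<delta>" "\<And>t \<xi> \<mu>. \<lbrakk>0 \<le> t; norm \<xi> \<le> R; norm \<mu> \<le> \<delta>\<rbrakk> \<Longrightarrow>
      norm (f t \<xi> \<mu> - f t \<xi> 0) < e"
    using f(2) R e unfolding SL4_def by metis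
  have \<gamma>: "0 < \<gamma> \<delta>" "\<gamma> 0 = 0" using K \<delta>(1) by (force simp: class_K_def strict_mono_on_def)+
  define C where "C = N R * (2 / \<gamma> \<delta> + 1)"
  have C: "0 \<le> C" using N(2)[of R] R \<gamma> by (simp add: C_def)
  show ?thesis
  proof (rule that[OF C])
    fix t :: real and \<xi> :: 'x and \<mu> :: 'u
    assume h: "0 \<le> t" "norm \<xi> \<le> R"
    have \<mu>: "0 \<le> \<gamma> (norm \<mu>)" by (rule class_K_nonneg[OF K]) simp
    show "norm (f t \<xi> \<mu> - f t \<xi> 0) \<le> e + C * \<gamma> (norm \<mu>)"
    proof (cases "norm \<mu> \<le> \<delta>")
      case True
      then have "norm (f t \<xi> \<mu> - f t \<xi> 0) \<le> e" using \<delta>(2)[OF h True] by simp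
      then show ?thesis using C \<mu> by (simp add: add_increasing2)
    next
      case False
      then have "\<gamma> \<delta> \<le> \<gamma> (norm \<mu>)" using \<delta>(1) by (intro class_K_mono[OF K]) auto
      then have two: "2 \<le> 2 / \<gamma> \<delta> * \<gamma> (norm \<mu>)" using \<gamma> by (simp add: field_simps)
      have NR: "N (norm \<xi>) \<le> N R" using h R by (intro mono_onD[OF N(1)]) auto
      have "norm (f t \<xi> \<mu> - f t \<xi> 0) \<le> norm (f t \<xi> \<mu>) + norm (f t \<xi> 0)"
        by (rule norm_triangle_ineq4)
      also have "\<dots> \<le> N (norm \<xi>) * (1 + \<gamma> (norm \<mu>)) + N (norm \<xi>) * (1 + \<gamma> (norm (0::'u)))"
        by (intro add_mono N(3) h)
      also have "\<dots> = N (norm \<xi>) * (2 + \<gamma> (norm \<mu>))" using \<gamma> by (simp add: algebra_simps)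
      also have "\<dots> \<le> N R * (2 + \<gamma> (norm \<mu>))" using NR \<mu> by (intro mult_right_mono) auto
      also have "\<dots> \<le> N R * (2 / \<gamma> \<delta> * \<gamma> (norm \<mu>) + \<gamma> (norm \<mu>))"
        using two N(2)[of R] R by (intro mult_left_mono) auto
      also have "\<dots> = C * \<gamma> (norm \<mu>)" by (simp add: C_def algebra_simps)
      finally show ?thesis using e by simp
    qed
  qed
qed

lemma gain_of_input_integrable:
  assumes K: "class_K \<gamma>" and u: "admissible_input u" and a: "0 \<le> a"
  shows "(\<lambda>s. \<gamma> (norm (u s))) integrable_on {a..b}"
proof -
  have lim: "((\<lambda>s. \<gamma> (norm (u s))) \<longlongrightarrow> \<gamma> (norm l)) F" if "(u \<longlongrightarrow> l) F" for l F
    using K by (intro continuous_on_tendsto_compose[of "{0..}" \<gamma>] tendsto_norm that)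
      (auto simp: class_K_def)
  have "regulated_on a b u" by (rule admissible_regulated[OF u a])
  then have "regulated_on a b (\<lambda>s. \<gamma> (norm (u s)))"
    unfolding regulated_on_def using lim by meson
  then show ?thesis by (rule regulated_on_integrable)
qed

lemma admissible_zero: "admissible_input (\<lambda>_. 0)"
  by (auto simp: admissible_input_def intro!: tendsto_const)

text \<open>By Gronwall the displacement is at most \<open>A\<close> times the integrated effect of the input, where \<open>A\<close> depends
only on the radius and the window length; the pointwise error \<open>e\<close> is chosen after \<open>A\<close>.\<close>

lemma flow_perturbation:
  fixes T :: "real \<Rightarrow> 'x::banach \<Rightarrow>\<^sub>L 'x"
    and f :: "real \<Rightarrow> 'x \<Rightarrow> 'u::real_normed_vector \<Rightarrow> 'x"
  assumes T: "C0_semigroup T" and f: "SL1 f" "SL2 f" "SL3 \<gamma> f" "SL4 f"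
    and fc: "forward_complete T f" and R: "0 < R" and \<tau>: "0 < \<tau>" and \<eta>: "0 < \<eta>"
  obtains C where "0 \<le> C" "\<And>t0 x u t. \<lbrakk>0 \<le> t0; admissible_input u;
      \<And>s. s \<in> {t0..t0 + \<tau>} \<Longrightarrow> norm (flow T f s t0 x u) \<le> R \<and> norm (flow T f s t0 x (\<lambda>_. 0)) \<le> R;
      t \<in> {t0..t0 + \<tau>}\<rbrakk> \<Longrightarrow> norm (flow T f t t0 x u - flow T f t t0 x (\<lambda>_. 0))
        \<le> \<eta> + C * integral {t0..t0 + \<tau>} (\<lambda>s. \<gamma> (norm (u s)))"
proof -
  have K: "class_K \<gamma>" using f(3) by (simp add: SL3_def class_Kinf_def)
  obtain M where M: "0 < M" "\<And>s. \<lbrakk>0 \<le> s; s \<le> \<tau>\<rbrakk> \<Longrightarrow> norm (T s) \<le> M"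
    using C0_semigroup_locally_bounded[OF T] by blast
  obtain L where L: "0 \<le> L" "\<And>t \<xi> \<omega> \<mu>. \<lbrakk>0 \<le> t; norm \<xi> \<le> R; norm \<omega> \<le> R; norm \<mu> \<le> R\<rbrakk> \<Longrightarrow>
     norm (f t \<xi> \<mu> - f t \<omega> \<mu>) \<le> L * norm (\<xi> - \<omega>)"
    by (rule SL2_lipschitz[OF f(2) R]) blast
  define A where "A = M * exp (M * L * \<tau>)"
  have A: "0 < A" using M by (simp add: A_def)
  \<comment> \<open>Integrated over the window and multiplied by \<open>A\<close>, this error contributes exactly \<open>\<eta>\<close>.\<close>
  define e where "e = \<eta> / (A * \<tau>)"
  have e: "0 < e" using A \<tau> \<eta> by (simp add: e_def)
  obtain C where C: "0 \<le> C" "\<And>t \<xi> \<mu>. \<lbrakk>0 \<le> t; norm \<xi> \<le> R\<rbrakk> \<Longrightarrow>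
    norm (f t \<xi> \<mu> - f t \<xi> 0) \<le> e + C * \<gamma> (norm \<mu>)"
    by (rule SL3_SL4_input_effect[OF f(3,4) R e]) blast
  show ?thesis
  proof (rule that[of "A * C"])
    show "0 \<le> A * C" using A C by simp
    fix t0 t :: real and x :: 'x and u :: "real \<Rightarrow> 'u"
    assume h: "0 \<le> t0" "admissible_input u"
      "\<And>s. s \<in> {t0..t0 + \<tau>} \<Longrightarrow> norm (flow T f s t0 x u) \<le> R \<and> norm (flow T f s t0 x (\<lambda>_. 0)) \<le> R"
      "t \<in> {t0..t0 + \<tau>}"
    let ?b = "t0 + \<tau>" and ?x = "\<lambda>t. flow T f t t0 x u" and ?z = "\<lambda>t. flow T f t t0 x (\<lambda>_. 0)"
    let ?w = "\<lambda>s. e + C * \<gamma> (norm (u s))"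
    have x: "mild_solution T f t0 x u ?b ?x"
      using fc h(1,2) by (intro flow_mild_solution[OF T f(1,2)]) (auto simp: forward_complete_def)
    have z: "mild_solution T f t0 x (\<lambda>_. 0) ?b ?z"
      using fc h(1) admissible_zero by (intro flow_mild_solution[OF T f(1,2)]) (auto simp: forward_complete_def)
    have gint: "(\<lambda>s. \<gamma> (norm (u s))) integrable_on {t0..?b}"
      by (rule gain_of_input_integrable[OF K h(2,1)])
    have \<gamma>: "0 \<le> \<gamma> (norm (u s))" for s by (rule class_K_nonneg[OF K]) simp
    have wint: "?w integrable_on {t0..?b}"
      by (intro integrable_add integrable_on_mult_right gint integrable_const_ivl)
    have "norm (?x t - ?z t) \<le> M * integral {t0..?b} ?w * exp (M * L * (t - t0))"
    proof (rule mild_solution_difference[OF x z _ M(2) L(1) wint _ _ h(4)])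
      fix s assume s: "s \<in> {t0..?b}"
      then show "0 \<le> ?w s" using e C \<gamma> by simp
      have "norm (f s (?x s) (u s) - f s (?z s) 0)
          \<le> norm (f s (?x s) (u s) - f s (?x s) 0) + norm (f s (?x s) 0 - f s (?z s) 0)"
        by (rule norm_diff_triangle_le[OF order_refl order_refl])
      also have "\<dots> \<le> ?w s + L * norm (?x s - ?z s)"
        using s h(1) h(3)[OF s] R by (intro add_mono C(2) L(2)) auto
      finally show "norm (f s (?x s) (u s) - f s (?z s) 0) \<le> ?w s + L * norm (?x s - ?z s)" .
    qed (use M in auto)
    also have "\<dots> \<le> M * integral {t0..?b} ?w * exp (M * L * \<tau>)"
    proof (rule mult_left_mono)
      show "exp (M * L * (t - t0)) \<le> exp (M * L * \<tau>)"
        using M L h(4) by (auto intro!: mult_left_mono)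
      have "0 \<le> integral {t0..?b} ?w"
        using e C \<gamma> by (intro integral_nonneg wint) auto
      then show "0 \<le> M * integral {t0..?b} ?w" using M by simp
    qed
    also have "integral {t0..?b} ?w = e * \<tau> + C * integral {t0..?b} (\<lambda>s. \<gamma> (norm (u s)))"
      using gint \<tau> by (simp add: integral_add integrable_on_mult_right integrable_const_ivl)
    also have "M * (e * \<tau> + C * integral {t0..?b} (\<lambda>s. \<gamma> (norm (u s)))) * exp (M * L * \<tau>)
        = A * e * \<tau> + A * C * integral {t0..?b} (\<lambda>s. \<gamma> (norm (u s)))"
      by (simp add: A_def algebra_simps)
    also have "A * e * \<tau> = \<eta>" using A \<tau> by (simp add: e_def)
    finally show "norm (?x t - ?z t) \<le> \<eta> + A * C * integral {t0..?b} (\<lambda>s. \<gamma> (norm (u s)))" .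
  qed
qed

section \<open>Input energies\<close>

lemma class_Kinf_max:
  assumes "class_Kinf a" "class_Kinf b"
  shows "class_Kinf (\<lambda>r. max (a r) (b r))"
proof -
  have "bdd_above (a ` {0..})" if "bdd_above ((\<lambda>r. max (a r) (b r)) ` {0..})"
    using that by (force simp: bdd_above_def)
  moreover have "continuous_on {0..} (\<lambda>r. max (a r) (b r))"
    using assms by (intro continuous_on_max) (auto simp: class_Kinf_def class_K_def)
  moreover have "max (a r) (b r) < max (a s) (b s)" if "0 \<le> r" "r < s" for r s
  proof -
    have "a r < a s" "b r < b s"
      using assms that by (auto simp: class_Kinf_def class_K_def strict_mono_on_def)
    then show ?thesis by (auto simp: less_max_iff_disj)
  qed
  ultimately show ?thesis
    using assms by (auto simp: class_Kinf_def class_K_def strict_mono_on_def le_max_iff_disj image_subset_iff)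
qed

lemma integral_le_input_energy:
  assumes K: "class_K \<gamma>" and le: "\<And>r. 0 \<le> r \<Longrightarrow> \<gamma> r \<le> \<kappa> r" and u: "admissible_input u" and a: "0 \<le> a"
    and fin: "input_energy \<kappa> u < \<infinity>"
  shows "integral {a..b} (\<lambda>s. \<gamma> (norm (u s))) \<le> enn2real (input_energy \<kappa> u)"
proof -
  let ?I = "integral {a..b} (\<lambda>s. \<gamma> (norm (u s)))"
  have "ennreal ?I = (\<integral>\<^sup>+s. ennreal (\<gamma> (norm (u s))) * indicator {a..b} s \<partial>lborel)"
    by (intro nn_integral_has_integral_lebesgue'[symmetric] class_K_nonneg[OF K] integrable_integral
        gain_of_input_integrable[OF K u a]) simp
  also have "\<dots> \<le> input_energy \<kappa> u"
    unfolding input_energy_def using a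
    by (intro nn_integral_mono mult_mono ennreal_leI le) (auto simp: indicator_def)
  finally have "enn2real (ennreal ?I) \<le> enn2real (input_energy \<kappa> u)"
    using fin by (intro enn2real_mono) auto
  moreover have "0 \<le> ?I"
    by (intro integral_nonneg gain_of_input_integrable[OF K u a] class_K_nonneg[OF K]) simp
  ultimately show ?thesis by simp
qed

lemma input_energy_zero:
  assumes "class_K \<kappa>"
  shows "input_energy \<kappa> (\<lambda>_. 0) = 0"
  using assms by (simp add: input_energy_def class_K_def)

lemma input_energy_mono:
  assumes "\<And>r. 0 \<le> r \<Longrightarrow> \<alpha> r \<le> \<kappa> r"
  shows "input_energy \<alpha> u \<le> input_energy \<kappa> u"
  unfolding input_energy_def
  by (intro nn_integral_mono mult_right_mono ennreal_leI assms) auto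

section \<open>The characterization\<close>

lemma iISS_imp_zero_GUAS:
  fixes T :: "real \<Rightarrow> 'x::real_normed_vector \<Rightarrow>\<^sub>L 'x"
    and f :: "real \<Rightarrow> 'x \<Rightarrow> 'u::real_normed_vector \<Rightarrow> 'x"
  assumes "iISS T f \<kappa>"
  shows "zero_GUAS T f"
proof -
  obtain \<beta> \<rho> where *: "class_KL \<beta>" "class_Kinf \<rho>" "\<And>t0 t x0 u. \<lbrakk>0 \<le> t0; t0 \<le> t; admissible_input u\<rbrakk> \<Longrightarrow>
      ennreal (norm (flow T f t t0 x0 u)) \<le> ennreal (\<beta> (norm x0) (t - t0)) + ext_gain \<rho> (input_energy \<kappa> u)"
    using assms unfolding iISS_def by blast
  have K: "class_K \<kappa>" "class_K \<rho>" and fc: "forward_complete T f"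
    using assms * by (auto simp: iISS_def class_Kinf_def)
  have "norm (flow T f t t0 x0 (\<lambda>_. 0)) \<le> \<beta> (norm x0) (t - t0)" if h: "0 \<le> t0" "t0 \<le> t" for t0 t x0
  proof -
    have "ext_gain \<rho> (input_energy \<kappa> (\<lambda>_. 0 :: 'u)) = 0"
      using K by (simp add: input_energy_zero ext_gain_def class_K_def)
    moreover have "0 \<le> \<beta> (norm x0) (t - t0)"
      using class_K_nonneg[of "\<lambda>r. \<beta> r (t - t0)" "norm x0"] *(1) h by (simp add: class_KL_def)
    ultimately show ?thesis using *(3)[OF h admissible_zero, of x0] by simp
  qed
  moreover have "globally_defined T f t0 x0 (\<lambda>_. 0)" if "0 \<le> t0" for t0 x0
    using fc that by (simp add: forward_complete_def admissible_zero)
  ultimately show ?thesis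
    unfolding zero_GUAS_def using *(1) by blast
qed

lemma iISS_imp_UBEBS:
  fixes T :: "real \<Rightarrow> 'x::real_normed_vector \<Rightarrow>\<^sub>L 'x"
    and f :: "real \<Rightarrow> 'x \<Rightarrow> 'u::real_normed_vector \<Rightarrow> 'x"
  assumes "iISS T f \<kappa>"
  shows "UBEBS T f \<kappa>"
proof -
  obtain \<beta> \<rho> where *: "class_KL \<beta>" "class_Kinf \<rho>" "\<And>t0 t x0 u. \<lbrakk>0 \<le> t0; t0 \<le> t; admissible_input u\<rbrakk> \<Longrightarrow>
      ennreal (norm (flow T f t t0 x0 u)) \<le> ennreal (\<beta> (norm x0) (t - t0)) + ext_gain \<rho> (input_energy \<kappa> u)"
    using assms unfolding iISS_def by blast
  \<comment> \<open>The linear term makes the function unbounded, which \<open>\<beta>\<close> need not be.\<close>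
  define a where "a r = \<beta> r 0 + r" for r
  have \<beta>0: "class_K (\<lambda>r. \<beta> r 0)" using *(1) by (simp add: class_KL_def)
  have "class_K a"
    using \<beta>0 by (auto simp: class_K_def a_def strict_mono_on_def image_subset_iff
        intro!: continuous_intros add_nonneg_nonneg add_strict_mono)
  moreover have "\<not> bdd_above (a ` {0..})"
  proof
    assume "bdd_above (a ` {0..})"
    then obtain B where B: "\<And>r. 0 \<le> r \<Longrightarrow> a r \<le> B" unfolding bdd_above_def by auto
    show False using B[of "\<bar>B\<bar> + 1"] class_K_nonneg[OF \<beta>0, of "\<bar>B\<bar> + 1"] by (simp add: a_def)
  qed
  ultimately have "class_Kinf a" by (simp add: class_Kinf_def)
  moreover have "ennreal (norm (flow T f t t0 x0 u)) \<le> ennreal (0 + a (norm x0)) + ext_gain \<rho> (input_energy \<kappa> u)"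
    if h: "0 \<le> t0" "t0 \<le> t" "admissible_input u" for t0 t x0 u
  proof -
    have "\<beta> (norm x0) (t - t0) \<le> \<beta> (norm x0) 0"
      using *(1) h by (auto simp: class_KL_def monotone_on_def)
    then have "ennreal (\<beta> (norm x0) (t - t0)) \<le> ennreal (0 + a (norm x0))"
      by (intro ennreal_leI) (simp add: a_def add_increasing2)
    then show ?thesis using *(3)[OF h, of x0] by (meson add_right_mono order_trans)
  qed
  ultimately show ?thesis
    using assms *(2) unfolding UBEBS_def iISS_def by (metis order_refl)
qed

text \<open>Inputs of infinite energy satisfy the estimate trivially, so the abstract result is applied to inputs with
finite \<open>max \<alpha> \<gamma>\<close>-energy. The \<open>\<alpha>\<close>-part of this energy gives the uniform bound on trajectories,
the \<open>\<gamma>\<close>-part controls the deviation from the unforced flow.\<close>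

lemma zero_GUAS_UBEBS_imp_iISS:
  fixes T :: "real \<Rightarrow> 'x::banach \<Rightarrow>\<^sub>L 'x"
    and f :: "real \<Rightarrow> 'x \<Rightarrow> 'u::real_normed_vector \<Rightarrow> 'x"
  assumes T: "C0_semigroup T" and f: "SL1 f" "SL2 f" "SL3 \<gamma> f" "SL4 f"
    and guas: "zero_GUAS T f" and ubebs: "UBEBS T f \<alpha>"
  shows "iISS T f (\<lambda>r. max (\<alpha> r) (\<gamma> r))"
proof -
  define \<kappa> where "\<kappa> = (\<lambda>r. max (\<alpha> r) (\<gamma> r))"
  have Kinf: "class_Kinf \<alpha>" "class_Kinf \<gamma>" and fc: "forward_complete T f"
    using ubebs f(3) by (auto simp: UBEBS_def SL3_def)
  then have K: "class_K \<gamma>" by (simp add: class_Kinf_def)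
  have \<kappa>: "class_Kinf \<kappa>" unfolding \<kappa>_def by (rule class_Kinf_max[OF Kinf])
  obtain \<beta> where \<beta>: "class_KL \<beta>" "\<And>t0 t x. \<lbrakk>0 \<le> t0; t0 \<le> t\<rbrakk> \<Longrightarrow>
      norm (flow T f t t0 x (\<lambda>_. 0)) \<le> \<beta> (norm x) (t - t0)"
    using guas unfolding zero_GUAS_def by blast
  obtain a \<rho> c where ub: "class_Kinf a" "class_Kinf \<rho>" "0 \<le> c"
    "\<And>t0 t x u. \<lbrakk>0 \<le> t0; t0 \<le> t; admissible_input u\<rbrakk> \<Longrightarrow> ennreal (norm (flow T f t t0 x u))
      \<le> ennreal (c + a (norm x)) + ext_gain \<rho> (input_energy \<alpha> u)"
    using ubebs unfolding UBEBS_def by blast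
  define U where "U = {u :: real \<Rightarrow> 'u. admissible_input u \<and> input_energy \<kappa> u < \<infinity>}"
  define en where "en u = enn2real (input_energy \<kappa> u)" for u :: "real \<Rightarrow> 'u"
  define w where "w u a b = integral {a..b} (\<lambda>s. \<gamma> (norm (u s)))" for u :: "real \<Rightarrow> 'u" and a b
  have ubU: "norm (flow T f t t0 x u) \<le> c + a r + \<rho> r"
    if h: "0 \<le> t0" "t0 \<le> t" "u \<in> U" "norm x \<le> r" "en u \<le> r" for t0 t x u r
  proof -
    have le: "input_energy \<alpha> u \<le> input_energy \<kappa> u" by (rule input_energy_mono) (simp add: \<kappa>_def)
    then have fin: "input_energy \<alpha> u < \<infinity>" using h(3) by (auto simp: U_def intro: le_less_trans)
    have aK: "class_K a" "class_K \<rho>" using ub by (auto simp: class_Kinf_def)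
    have "enn2real (input_energy \<alpha> u) \<le> en u"
      unfolding en_def using le h(3) by (intro enn2real_mono) (auto simp: U_def)
    then have er: "enn2real (input_energy \<alpha> u) \<le> r" using h(5) by simp
    have "ennreal (norm (flow T f t t0 x u)) \<le> ennreal (c + a (norm x)) + ennreal (\<rho> (enn2real (input_energy \<alpha> u)))"
      using ub(4)[OF h(1,2), of u x] h(3) less_imp_neq[OF fin] by (simp add: U_def ext_gain_def)
    also have "\<dots> \<le> ennreal (c + a r) + ennreal (\<rho> r)"
      using er h(4) by (intro add_mono ennreal_leI class_K_mono[OF aK(1)] class_K_mono[OF aK(2)]) auto
    also have "\<dots> = ennreal (c + a r + \<rho> r)"
      using ub(3) class_K_nonneg[OF aK(1), of r] class_K_nonneg[OF aK(2), of r] order_trans[OF norm_ge_zero h(4)]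
      by (intro ennreal_plus[symmetric]) auto
    finally show ?thesis
      using ub(3) class_K_nonneg[OF aK(1), of r] class_K_nonneg[OF aK(2), of r] order_trans[OF norm_ge_zero h(4)]
      by (subst (asm) ennreal_le_iff) auto
  qed
  interpret perturbed_flow "flow T f" U "\<lambda>_. 0" en w \<beta>
  proof
    show "flow T f t0 t0 x u = x" if "0 \<le> t0" "u \<in> U" for t0 x u
      using that fc by (intro flow_initial[OF T f(1,2)]) (auto simp: U_def forward_complete_def)
    show "flow T f t s (flow T f s t0 x u) u = flow T f t t0 x u"
      if "0 \<le> t0" "t0 \<le> s" "s \<le> t" "u \<in> U" for t0 s t u x
      using that by (intro flow_cocycle[OF T f(1,2) _ _ fc]) (auto simp: U_def)
    show "w u a c = w u a b + w u b c" if "0 \<le> a" "a \<le> b" "b \<le> c" "u \<in> U" for a b c u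
      unfolding w_def using that
      by (intro Henstock_Kurzweil_Integration.integral_combine[symmetric] gain_of_input_integrable[OF K])
        (auto simp: U_def)
    show "w u a b \<le> en u" if "0 \<le> a" "a \<le> b" "u \<in> U" for a b u
      unfolding w_def en_def using that
      by (intro integral_le_input_energy[OF K]) (auto simp: U_def \<kappa>_def)
    show "0 \<le> en u" for u by (simp add: en_def)
    show "\<exists>R. \<forall>t0\<ge>0. \<forall>t\<ge>t0. \<forall>x. \<forall>u\<in>U. norm x \<le> r \<longrightarrow> en u \<le> r \<longrightarrow> norm (flow T f t t0 x u) \<le> R" for r
      using ubU by blast
    show "class_KL \<beta>" by (rule \<beta>(1))
    show "norm (flow T f t t0 x (\<lambda>_. 0)) \<le> \<beta> (norm x) (t - t0)" if "0 \<le> t0" "t0 \<le> t" for t0 t x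
      using that by (rule \<beta>(2))
    show "\<exists>C\<ge>0. \<forall>t0\<ge>0. \<forall>x. \<forall>u\<in>U.
        (\<forall>t\<in>{t0..t0 + \<tau>}. norm (flow T f t t0 x u) \<le> R \<and> norm (flow T f t t0 x (\<lambda>_. 0)) \<le> R) \<longrightarrow>
        (\<forall>t\<in>{t0..t0 + \<tau>}. norm (flow T f t t0 x u - flow T f t t0 x (\<lambda>_. 0)) \<le> \<eta> + C * w u t0 (t0 + \<tau>))"
      if h: "0 < R" "0 < \<tau>" "0 < \<eta>" for R \<tau> \<eta>
    proof -
      obtain C where "0 \<le> C" "\<And>t0 x u t. \<lbrakk>0 \<le> t0; admissible_input u;
          \<And>s. s \<in> {t0..t0 + \<tau>} \<Longrightarrow> norm (flow T f s t0 x u) \<le> R \<and> norm (flow T f s t0 x (\<lambda>_. 0)) \<le> R;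
          t \<in> {t0..t0 + \<tau>}\<rbrakk> \<Longrightarrow> norm (flow T f t t0 x u - flow T f t t0 x (\<lambda>_. 0))
            \<le> \<eta> + C * integral {t0..t0 + \<tau>} (\<lambda>s. \<gamma> (norm (u s)))"
        by (rule flow_perturbation[OF T f fc h]) blast
      then show ?thesis by (intro exI[of _ C]) (auto simp: U_def w_def)
    qed
  qed
  obtain b \<sigma> where est: "class_KL b" "class_Kinf \<sigma>" "\<And>t0 t x u. \<lbrakk>0 \<le> t0; t0 \<le> t; u \<in> U\<rbrakk> \<Longrightarrow>
      norm (flow T f t t0 x u) \<le> b (norm x) (t - t0) + \<sigma> (en u)"
    using iISS_estimate by blast
  have "ennreal (norm (flow T f t t0 x u)) \<le> ennreal (b (norm x) (t - t0)) + ext_gain \<sigma> (input_energy \<kappa> u)"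
    if h: "0 \<le> t0" "t0 \<le> t" "admissible_input u" for t0 t x u
  proof (cases "input_energy \<kappa> u = \<infinity>")
    case False
    then have u: "u \<in> U" using h by (simp add: U_def less_top)
    have "0 \<le> b (norm x) (t - t0)" "0 \<le> \<sigma> (en u)"
      using est(1,2) h by (auto simp: class_KL_def class_K_def class_Kinf_def en_def image_subset_iff)
    then have "ennreal (b (norm x) (t - t0)) + ext_gain \<sigma> (input_energy \<kappa> u)
        = ennreal (b (norm x) (t - t0) + \<sigma> (en u))"
      using False by (simp add: ext_gain_def en_def)
    then show ?thesis using est(3)[OF h(1,2) u, of x] by (simp add: ennreal_leI)
  qed (simp add: ext_gain_def)
  then show ?thesis
    using \<kappa> fc est(1,2) unfolding iISS_def \<kappa>_def[symmetric] by blast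
qed

theorem theorem5p1:
  fixes D :: "'x::banach set" and A :: "'x \<Rightarrow> 'x"
    and T :: "real \<Rightarrow> 'x \<Rightarrow>\<^sub>L 'x"
    and f :: "real \<Rightarrow> 'x \<Rightarrow> 'u::real_normed_vector \<Rightarrow> 'x"
    and \<gamma> :: "real \<Rightarrow> real"
  assumes "C0_semigroup T" and "generates D A T"
    and "SL1 f" and "SL2 f" and "SL3 \<gamma> f" and "SL4 f"
  shows "(\<forall>\<kappa>. iISS T f \<kappa> \<longrightarrow> zero_GUAS T f \<and> UBEBS T f \<kappa>) \<and>
    (\<forall>\<alpha>. zero_GUAS T f \<and> UBEBS T f \<alpha> \<longrightarrow> iISS T f (\<lambda>r. max (\<alpha> r) (\<gamma> r)))"
  using iISS_imp_zero_GUAS iISS_imp_UBEBS zero_GUAS_UBEBS_imp_iISS[OF assms(1,3-6)] by blast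

end
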